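(* Let $f$ satisfy (f1) and suppose $f_0=+\infty$ and $f_\infty\in(0,+\infty)$. Then for every $\lambda\in(0,\lambda_1/f_\infty)$, problem (MO) has two solutions $u^+$ and $u^-$ such that $u^+$ is positive and strictly concave in $(0,1)$ and $u^-$ is negative and strictly convex in $(0,1)$.
   Context: Let $N\ge 1$ be an integer and $f:\mathbb{R}\to\mathbb{R}$ continuous. For $\lambda\ge 0$, problem (MO) is: find $u\in C^2[0,1]$ with $\left((u'(r))^N\right)'=\lambda^N N r^{N-1} f(-u(r))$ for $0<r<1$ and $u'(0)=u(1)=0$. Condition (f1): $f\in C(\mathbb{R},\mathbb{R})$ and $f(s)s^N>0$ for all $s\neq0$. The quantities $f_0,f_\infty\in[0,+\infty]$ are defined by $f_0^N=\lim_{s\to0} f(s)/s^N$ and $f_\infty^N=\lim_{|s|\to+\infty} f(s)/s^N$ (limits assumed to exist in $[0,+\infty]$). $\lambda_1>0$ denotes the first eigenvalue of $\left((-v')^N\right)'=\lambda^N N r^{N-1}v^N$ in $(0,1)$, $v'(0)=v(1)=0$, i.e. the unique $\lambda>0$ for which this problem has a solution $v\in C^2[0,1]$ positive in $(0,1)$. *)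

theory Defs
  imports "HOL-Analysis.Analysis"
begin

definition strictly_convex_on :: "real set \<Rightarrow> (real \<Rightarrow> real) \<Rightarrow> bool" where
  "strictly_convex_on S g \<longleftrightarrow>
     (\<forall>x\<in>S. \<forall>y\<in>S. \<forall>t. x \<noteq> y \<longrightarrow> 0 < t \<longrightarrow> t < 1 \<longrightarrow>
        g ((1 - t) * x + t * y) < (1 - t) * g x + t * g y)"

definition strictly_concave_on :: "real set \<Rightarrow> (real \<Rightarrow> real) \<Rightarrow> bool" where
  "strictly_concave_on S g \<longleftrightarrow> strictly_convex_on S (\<lambda>x. - g x)"

definition C2_01 :: "(real \<Rightarrow> real) \<Rightarrow> (real \<Rightarrow> real) \<Rightarrow> (real \<Rightarrow> real) \<Rightarrow> bool" where
  "C2_01 u u' u'' \<longleftrightarrow>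
     continuous_on {0..1} u'' \<and>
     (\<forall>r\<in>{0..1}. (u has_real_derivative u' r) (at r within {0..1}) \<and>
                  (u' has_real_derivative u'' r) (at r within {0..1}))"

definition MO_solution :: "nat \<Rightarrow> (real \<Rightarrow> real) \<Rightarrow> real \<Rightarrow> (real \<Rightarrow> real) \<Rightarrow> bool" where
  "MO_solution N f lam u \<longleftrightarrow>
     (\<exists>u' u''. C2_01 u u' u'' \<and>
        (\<forall>r\<in>{0<..<1}. ((\<lambda>t. (u' t) ^ N) has_real_derivative
              (lam ^ N * real N * r ^ (N - 1) * f (- u r))) (at r)) \<and>
        u' 0 = 0 \<and> u 1 = 0)"

definition eigen_solution :: "nat \<Rightarrow> real \<Rightarrow> (real \<Rightarrow> real) \<Rightarrow> bool" where
  "eigen_solution N lam v \<longleftrightarrow>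
     (\<exists>v' v''. C2_01 v v' v'' \<and>
        (\<forall>r\<in>{0<..<1}. ((\<lambda>t. (- v' t) ^ N) has_real_derivative
              (lam ^ N * real N * r ^ (N - 1) * (v r) ^ N)) (at r)) \<and>
        v' 0 = 0 \<and> v 1 = 0)"

definition lambda1 :: "nat \<Rightarrow> real" where
  "lambda1 N = (THE lam. lam > 0 \<and>
      (\<exists>v. eigen_solution N lam v \<and> (\<forall>r\<in>{0<..<1}. v r > 0)))"

end

theory Submission
  imports Defs "HOL-Complex_Analysis.Great_Picard"
begin

text \<open>
  Up to reflection both solutions are positive decreasing solutions \<open>V\<close> of
  \<open>((-V')\<^sup>N)' = \<lambda>\<^sup>N N r\<^bsup>N-1\<^esup> g(V)\<close>, \<open>V'(0) = V(1) = 0\<close>, where \<open>g(s)\<close> is \<open>f(s)\<close> or \<open>(-1)\<^sup>N f(-s)\<close>.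
  Let \<open>\<phi>\<close> be the first eigenfunction. Because \<open>f\<^sub>0 = \<infinity>\<close>, a small multiple \<open>k \<phi>\<close> is a
  subsolution; because \<open>\<lambda> f\<^sub>\<infinity> < \<lambda>\<^sub>1\<close>, a large multiple \<open>M \<phi>(c r)\<close> with \<open>c < 1\<close> close to 1 is a
  supersolution. After truncating \<open>g(V)\<close> between the two, the right-hand side is bounded, and the
  boundary value problem is solved by shooting: for the equation with a delay the solution depends
  continuously on its initial value, so the intermediate value theorem yields \<open>V(1) = 0\<close>, and
  the delay is sent to 0 with the Arzela-Ascoli theorem. Monotonicity of the integrated equation in the
  density forces the solution between the two barriers, where the truncation is inactive.
  The same existence result produces \<open>\<phi>\<close> from an initial value problem by rescaling to the first
  zero, and \<open>\<lambda>\<^sub>1\<close> is unique since \<open>w \<ge> k v\<close> improves to \<open>w \<ge> (\<mu>/\<lambda>) k v\<close> for positive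
  eigenfunctions \<open>v\<close>, \<open>w\<close> with eigenvalues \<open>\<lambda> < \<mu>\<close>.
\<close>

section \<open>The integrated radial equation\<close>

text \<open>The equation \<open>((-V')\<^sup>N)' = N r\<^bsup>N-1\<^esup> h\<close>, \<open>V'(0) = 0\<close>, \<open>V' \<le> 0\<close> in integrated form:
  \<open>mass N h r\<close> is the right-hand side integrated from 0 to \<open>r\<close>, so that \<open>V' = - root N (mass N h r)\<close>.\<close>

definition mass :: "nat \<Rightarrow> (real \<Rightarrow> real) \<Rightarrow> real \<Rightarrow> real" where
  "mass N h r = integral {0..r} (\<lambda>t. real N * t ^ (N - 1) * h t)"

definition radial :: "nat \<Rightarrow> (real \<Rightarrow> real) \<Rightarrow> (real \<Rightarrow> real) \<Rightarrow> bool" where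
  "radial N h V \<longleftrightarrow> continuous_on {0..1} h \<and> (\<forall>r\<in>{0..1}. 0 \<le> h r) \<and>
     (\<forall>r\<in>{0..1}. (V has_real_derivative - root N (mass N h r)) (at r within {0..1}))"

section \<open>Calculus of the integrated density\<close>

lemma mass_0 [simp]: "mass N h 0 = 0"
  by (simp add: mass_def)

lemma mass_has_derivative:
  assumes "continuous_on {0..1} h" "r \<in> {0..1}"
  shows "(mass N h has_real_derivative real N * r ^ (N - 1) * h r) (at r within {0..1})"
proof -
  have "continuous_on {0..1} (\<lambda>t. real N * t ^ (N - 1) * h t)"
    by (intro continuous_intros assms)
  from integral_has_real_derivative[OF this assms(2)]
  show ?thesis unfolding mass_def[abs_def] .
qed

lemma has_derivative_interior_unit:
  assumes "(g has_real_derivative D) (at r within {0..1})" "0 < r" "r < 1"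
  shows "(g has_real_derivative D) (at r)"
  using assms at_within_Icc_at[of 0 r 1] by simp

lemma continuous_on_mass:
  assumes "continuous_on {0..1} h"
  shows "continuous_on {0..1} (mass N h)"
  by (rule DERIV_continuous_on[OF mass_has_derivative[OF assms]])

lemma mass_integrable:
  assumes "continuous_on {0..1} h" "r \<le> 1"
  shows "(\<lambda>t. real N * t ^ (N - 1) * h t) integrable_on {0..r}"
  by (intro integrable_continuous_real continuous_intros continuous_on_subset[OF assms(1)])
     (use assms in auto)

lemma mass_mono:
  assumes "continuous_on {0..1} h" "continuous_on {0..1} k" "r \<le> 1"
    and "\<And>t. 0 \<le> t \<Longrightarrow> t \<le> r \<Longrightarrow> h t \<le> k t"
  shows "mass N h r \<le> mass N k r"
  unfolding mass_def
  by (rule integral_le[OF mass_integrable mass_integrable])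
     (use assms in \<open>auto intro!: mult_left_mono\<close>)

lemma mass_cong:
  assumes "\<And>t. 0 \<le> t \<Longrightarrow> t \<le> r \<Longrightarrow> h t = k t"
  shows "mass N h r = mass N k r"
  unfolding mass_def by (rule integral_cong) (use assms in auto)

text \<open>By the fundamental theorem of calculus. Derivatives are required only in the open
  interval, so an equation posed on \<open>{0<..<1}\<close> can be integrated directly.\<close>

lemma mass_unique:
  assumes "continuous_on {0..1} J" "J 0 = 0" "r \<in> {0..1}"
    and "\<And>t. 0 < t \<Longrightarrow> t < 1 \<Longrightarrow> (J has_real_derivative real N * t ^ (N - 1) * h t) (at t)"
  shows "mass N h r = J r"
proof -
  have "((\<lambda>t. real N * t ^ (N - 1) * h t) has_integral J r - J 0) {0..r}"
  proof (rule fundamental_theorem_of_calculus_interior)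
    show "continuous_on {0..r} J" using assms(3) by (intro continuous_on_subset[OF assms(1)]) auto
    show "(J has_vector_derivative real N * t ^ (N - 1) * h t) (at t)" if "t \<in> {0<..<r}" for t
      using assms(4)[of t] that assms(3) by (simp add: has_real_derivative_iff_has_vector_derivative)
  qed (use assms in auto)
  then show ?thesis using assms(2) by (simp add: mass_def integral_unique)
qed

lemma mass_const:
  assumes "N \<ge> 1" "r \<in> {0..1}"
  shows "mass N (\<lambda>_. c) r = c * r ^ N"
proof (rule mass_unique)
  show "((\<lambda>r. c * r ^ N) has_real_derivative real N * t ^ (N - 1) * c) (at t)" for t
    by (auto intro!: derivative_eq_intros)
qed (use assms in \<open>auto intro!: continuous_intros\<close>)

lemma mass_scale: "mass N (\<lambda>t. c * h t) r = c * mass N h r"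
  unfolding mass_def by (simp add: mult.left_commute)

lemma mass_nonneg:
  assumes "continuous_on {0..1} h" "r \<le> 1" "\<And>t. 0 \<le> t \<Longrightarrow> t \<le> r \<Longrightarrow> 0 \<le> h t"
  shows "0 \<le> mass N h r"
  unfolding mass_def by (rule integral_nonneg[OF mass_integrable]) (use assms in auto)

lemma mass_strict_mono:
  assumes "N \<ge> 1" "continuous_on {0..1} h" "\<And>t. 0 < t \<Longrightarrow> t < 1 \<Longrightarrow> 0 < h t"
    and "0 \<le> r" "r < s" "s \<le> 1"
  shows "mass N h r < mass N h s"
proof (rule DERIV_pos_imp_increasing_open[OF \<open>r < s\<close>])
  fix t assume t: "r < t" "t < s"
  have "(mass N h has_real_derivative real N * t ^ (N - 1) * h t) (at t)"
    using mass_has_derivative[OF assms(2), of t N] assms t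
    by (intro has_derivative_interior_unit) auto
  moreover have "0 < real N * t ^ (N - 1) * h t" using assms t by simp
  ultimately show "\<exists>y. (mass N h has_real_derivative y) (at t) \<and> 0 < y" by blast
qed (use assms in \<open>intro continuous_on_subset[OF continuous_on_mass], auto\<close>)

lemma mass_pos:
  assumes "N \<ge> 1" "continuous_on {0..1} h" "\<And>t. 0 < t \<Longrightarrow> t < 1 \<Longrightarrow> 0 < h t"
    and "0 < r" "r \<le> 1"
  shows "0 < mass N h r"
  using mass_strict_mono[OF assms(1-3), of 0 r] assms by simp

lemma mass_mono_radius:
  assumes "continuous_on {0..1} h" "\<And>t. 0 \<le> t \<Longrightarrow> t \<le> 1 \<Longrightarrow> 0 \<le> h t" "0 \<le> r" "r \<le> s" "s \<le> 1"
  shows "mass N h r \<le> mass N h s"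
  unfolding mass_def
  by (rule integral_subset_le[OF _ mass_integrable mass_integrable]) (use assms in auto)

text \<open>Both sides vanish at 0 and have the same derivative in \<open>r\<close>. The factor
  \<open>c ^ N\<close> combines \<open>c ^ (N - 1)\<close> from the weight with one \<open>c\<close>
  from the chain rule.\<close>

lemma mass_dilate:
  assumes "N \<ge> 1" "continuous_on {0..1} h" "0 \<le> c" "c \<le> 1" "r \<in> {0..1}"
  shows "mass N (\<lambda>t. c ^ N * h (c * t)) r = mass N h (c * r)"
proof (cases "c = 0")
  case True then show ?thesis using assms by (simp add: mass_def power_0_left)
next
  case False
  show ?thesis
  proof (rule mass_unique)
    have 1: "continuous_on {0..1} (\<lambda>r. c * r)" by (intro continuous_intros)
    have 2: "(\<lambda>r. c * r) ` {0..1} \<subseteq> {0..1}" using assms by (auto intro: mult_le_one)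
    show "continuous_on {0..1} (\<lambda>r. mass N h (c * r))"
      by (rule continuous_on_compose2[OF continuous_on_mass[OF assms(2)] 1 2])
    fix t :: real assume t: "0 < t" "t < 1"
    have "c * t \<le> t" using t assms by simp
    then have ct: "0 < c * t" "c * t < 1" using t assms(3) False by (simp, linarith)
    have "(mass N h has_real_derivative real N * (c*t) ^ (N - 1) * h (c*t)) (at (c*t))"
      using mass_has_derivative[OF assms(2), of "c*t" N] ct
      by (intro has_derivative_interior_unit) auto
    moreover have "((\<lambda>t. c * t) has_real_derivative c) (at t)"
      by (auto intro!: derivative_eq_intros)
    ultimately have "((\<lambda>r. mass N h (c * r)) has_real_derivative real N * (c*t) ^ (N - 1) * h (c*t) * c) (at t)"
      by (rule DERIV_chain2[where g = "\<lambda>t. c * t"])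
    moreover have "c ^ N = c * c ^ (N - 1)" using assms(1) by (cases N) auto
    ultimately show "((\<lambda>r. mass N h (c * r)) has_real_derivative
        real N * t ^ (N - 1) * (c ^ N * h (c * t))) (at t)"
      by (simp add: power_mult_distrib algebra_simps)
  qed (use assms in auto)
qed

section \<open>Scaling, monotonicity and comparison of radial profiles\<close>

lemma radial_continuous_on: "radial N h V \<Longrightarrow> continuous_on {0..1} V"
  unfolding radial_def by (intro DERIV_continuous_on[of "{0..1}" V "\<lambda>r. - root N (mass N h r)"]) auto

lemma radial_has_derivative:
  "radial N h V \<Longrightarrow> 0 < r \<Longrightarrow> r < 1 \<Longrightarrow> (V has_real_derivative - root N (mass N h r)) (at r)"
  unfolding radial_def by (auto intro: has_derivative_interior_unit)

lemma radial_cong: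
  assumes "radial N h V" "\<And>t. t \<in> {0..1} \<Longrightarrow> h t = k t"
  shows "radial N k V"
proof -
  have "mass N h r = mass N k r" if "r \<in> {0..1}" for r
    by (rule mass_cong) (use assms(2) that in auto)
  moreover have "continuous_on {0..1} k"
    using assms continuous_on_cong[of "{0..1}" "{0..1}" h k] by (simp add: radial_def)
  ultimately show ?thesis using assms unfolding radial_def by simp
qed

lemma radial_scale:
  assumes "radial N h V" "N \<ge> 1" "0 \<le> c"
  shows "radial N (\<lambda>t. c ^ N * h t) (\<lambda>t. c * V t)"
proof -
  have "((\<lambda>t. c * V t) has_real_derivative - root N (mass N (\<lambda>t. c ^ N * h t) r)) (at r within {0..1})"
    if "r \<in> {0..1}" for r
  proof -
    have "(V has_real_derivative - root N (mass N h r)) (at r within {0..1})"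
      using assms(1) that unfolding radial_def by blast
    from DERIV_cmult[OF this, of c] show ?thesis
      using assms by (simp add: mass_scale real_root_mult real_root_power_cancel)
  qed
  moreover have "continuous_on {0..1} (\<lambda>t. c ^ N * h t)"
    using assms(1) unfolding radial_def by (intro continuous_intros) auto
  ultimately show ?thesis using assms unfolding radial_def by simp
qed

text \<open>One factor \<open>c\<close> comes from the chain rule and another from dilating the
  mass, whence \<open>(c^2) ^ N\<close>. For an eigenfunction this multiplies the parameter by
  \<open>c^2\<close>.\<close>

lemma radial_dilate:
  assumes "radial N h V" "N \<ge> 1" "0 \<le> c" "c \<le> 1"
  shows "radial N (\<lambda>t. (c^2) ^ N * h (c * t)) (\<lambda>t. V (c * t))"
proof -
  have h: "continuous_on {0..1} h" using assms by (simp add: radial_def)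
  have 1: "continuous_on {0..1} (\<lambda>r. c * r)" by (intro continuous_intros)
  have 2: "(\<lambda>r. c * r) ` {0..1} \<subseteq> {0..1}" using assms by (auto intro: mult_le_one)
  have "((\<lambda>t. V (c * t)) has_real_derivative - root N (mass N (\<lambda>t. (c^2) ^ N * h (c * t)) r))
      (at r within {0..1})" if r: "r \<in> {0..1}" for r
  proof -
    have "(V has_real_derivative - root N (mass N h (c * r))) (at (c * r) within {0..1})"
      using assms(1) r 2 unfolding radial_def by blast
    then have D: "(V has_real_derivative - root N (mass N h (c * r))) (at (c * r) within (\<lambda>r. c * r) ` {0..1})"
      using 2 by (rule DERIV_subset)
    have "((\<lambda>r. c * r) has_real_derivative c) (at r within {0..1})"
      by (auto intro!: derivative_eq_intros)
    from DERIV_image_chain[OF D this]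
    have "((\<lambda>t. V (c * t)) has_real_derivative c * (- root N (mass N h (c * r)))) (at r within {0..1})"
      by (simp add: o_def mult.commute)
    moreover have "mass N (\<lambda>t. (c^2) ^ N * h (c * t)) r = c ^ N * mass N h (c * r)"
      unfolding mass_dilate[OF assms(2) h assms(3,4) r, symmetric] mass_scale[symmetric]
      by (simp add: power2_eq_square power_mult_distrib mult.assoc)
    ultimately show ?thesis
      using assms by (simp add: real_root_mult real_root_power_cancel)
  qed
  moreover have "continuous_on {0..1} (\<lambda>t. (c^2) ^ N * h (c * t))"
    by (intro continuous_intros continuous_on_compose2[OF h 1 2])
  moreover have "0 \<le> h (c * t)" if "t \<in> {0..1}" for t
    using assms(1) 2 that unfolding radial_def by blast
  ultimately show ?thesis unfolding radial_def by simp
qed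

lemma radial_antimono:
  assumes V: "radial N h V" and "0 \<le> r" "r \<le> s" "s \<le> 1"
  shows "V s \<le> V r"
proof (rule DERIV_nonpos_imp_decreasing_open[OF \<open>r \<le> s\<close>])
  show "continuous_on {r..s} V"
    using assms by (intro continuous_on_subset[OF radial_continuous_on[OF V]]) auto
  fix t assume t: "r < t" "t < s"
  have "0 \<le> mass N h t"
    using V t assms(2,4) unfolding radial_def by (intro mass_nonneg) auto
  then show "\<exists>y. (V has_real_derivative y) (at t) \<and> y \<le> 0"
    using radial_has_derivative[OF V, of t] t assms(2,4)
    by (intro exI[of _ "- root N (mass N h t)"]) (auto intro: real_root_ge_zero)
qed

text \<open>The larger density descends faster, so \<open>V - W\<close> is nonincreasing and its
  sign at 1 propagates to the left. This plays the part of a maximum principle.\<close>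

lemma radial_compare:
  assumes V: "radial N h V" and W: "radial N k W" and "N \<ge> 1"
    and le: "\<And>t. t \<in> {0..1} \<Longrightarrow> k t \<le> h t" and "W 1 \<le> V 1" and r: "r \<in> {0..1}"
  shows "W r \<le> V r"
proof -
  have "V 1 - W 1 \<le> V r - W r"
  proof (rule DERIV_nonpos_imp_decreasing_open[where f = "\<lambda>t. V t - W t"])
    show "continuous_on {r..1} (\<lambda>t. V t - W t)"
      by (rule continuous_on_subset[OF continuous_on_diff[OF radial_continuous_on[OF V]
          radial_continuous_on[OF W]]]) (use r in auto)
    fix t assume t: "r < t" "t < 1"
    then have D: "((\<lambda>t. V t - W t) has_real_derivative
        (- root N (mass N h t)) - (- root N (mass N k t))) (at t)"
      using r by (intro DERIV_diff radial_has_derivative[OF V] radial_has_derivative[OF W]) auto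
    have "mass N k t \<le> mass N h t"
      using V W le t r unfolding radial_def by (intro mass_mono) auto
    then have "root N (mass N k t) \<le> root N (mass N h t)" using assms(3) by simp
    with D show "\<exists>y. ((\<lambda>t. V t - W t) has_real_derivative y) (at t) \<and> y \<le> 0"
      by (intro exI conjI) auto
  qed (use r in auto)
  then show ?thesis using assms by simp
qed

section \<open>Strict convexity from a strictly increasing derivative\<close>

lemma strictly_convex_onI_derivative:
  fixes g g' :: "real \<Rightarrow> real"
  assumes cont: "continuous_on {a..b} g"
    and der: "\<And>x. a < x \<Longrightarrow> x < b \<Longrightarrow> (g has_real_derivative g' x) (at x)"
    and mono: "\<And>x y. a < x \<Longrightarrow> x < y \<Longrightarrow> y < b \<Longrightarrow> g' x < g' y"
  shows "strictly_convex_on {a..b} g"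
proof -
  have *: "g ((1 - t) * x + t * y) < (1 - t) * g x + t * g y"
    if xy: "a \<le> x" "x < y" "y \<le> b" and t: "0 < t" "t < 1" for x y t
  proof -
    define z where "z = (1 - t) * x + t * y"
    have z1: "z - x = t * (y - x)" and z2: "y - z = (1 - t) * (y - x)"
      unfolding z_def by (simp_all add: algebra_simps)
    have "0 < z - x" "0 < y - z" unfolding z1 z2 using xy t by auto
    then have z: "x < z" "z < y" by auto
    have diff: "g differentiable (at s)" if "a \<le> c" "d \<le> b" "c < s" "s < d" for c d s
      using der[of s] that real_differentiable_def by fastforce
    \<comment> \<open>The chord slopes on the two sides of \<open>z\<close> are values of
      \<open>g'\<close> at points \<open>p < z < q\<close>, hence strictly ordered.\<close>
    obtain l p where p: "x < p" "p < z" "DERIV g p :> l" "g z - g x = (z - x) * l"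
      using MVT[OF z(1), of g] continuous_on_subset[OF cont, of "{x..z}"] diff[of x z] xy z by auto
    obtain m q where q: "z < q" "q < y" "DERIV g q :> m" "g y - g z = (y - z) * m"
      using MVT[OF z(2), of g] continuous_on_subset[OF cont, of "{z..y}"] diff[of z y] xy z by auto
    have "l = g' p" "m = g' q"
      using DERIV_unique[OF p(3) der[of p]] DERIV_unique[OF q(3) der[of q]] p q xy z by simp_all
    then have "l < m" using mono[of p q] p q xy z by simp
    then have "t * (1 - t) * (y - x) * l < t * (1 - t) * (y - x) * m"
      using t xy by simp
    moreover have "(1 - t) * (g z - g x) = t * (1 - t) * (y - x) * l"
      "t * (g y - g z) = t * (1 - t) * (y - x) * m"
      unfolding p(4) q(4) z1 z2 by (simp_all only: ac_simps)
    ultimately have "(1 - t) * (g z - g x) < t * (g y - g z)" by linarith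
    moreover have "(1 - t) * g x + t * g y - g z = t * (g y - g z) - (1 - t) * (g z - g x)"
      by (simp add: algebra_simps)
    ultimately show ?thesis unfolding z_def by linarith
  qed
  show ?thesis
    unfolding strictly_convex_on_def
  proof (intro ballI allI impI)
    fix x y t :: real assume A: "x \<in> {a..b}" "y \<in> {a..b}" "x \<noteq> y" "0 < t" "t < 1"
    show "g ((1 - t) * x + t * y) < (1 - t) * g x + t * g y"
    proof (cases "x < y")
      case True then show ?thesis using *[of x y t] A by simp
    next
      case False then show ?thesis using *[of y x "1 - t"] A by (simp add: add.commute)
    qed
  qed
qed

lemma radial_strictly_convex:
  assumes V: "radial N h V" and "N \<ge> 1" and pos: "\<And>t. 0 < t \<Longrightarrow> t < 1 \<Longrightarrow> 0 < h t"
  shows "strictly_convex_on {0..1} (\<lambda>r. - V r)"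
proof (rule strictly_convex_onI_derivative)
  show "continuous_on {0..1} (\<lambda>r. - V r)"
    by (intro continuous_intros radial_continuous_on[OF V])
  show "((\<lambda>r. - V r) has_real_derivative root N (mass N h x)) (at x)" if "0 < x" "x < 1" for x
    using DERIV_minus[OF radial_has_derivative[OF V that]] by simp
  show "root N (mass N h x) < root N (mass N h y)" if "0 < x" "x < y" "y < 1" for x y
    using mass_strict_mono[of N h x y] assms that by (simp add: radial_def)
qed

lemma strictly_convex_on_subset:
  "strictly_convex_on S g \<Longrightarrow> T \<subseteq> S \<Longrightarrow> strictly_convex_on T g"
  unfolding strictly_convex_on_def by blast

section \<open>Regularity\<close>

text \<open>The ratio is a weighted average of \<open>h\<close> over \<open>[0, r]\<close>. Near 0,
  \<open>h\<close> is squeezed between two constants, whose masses are known exactly, so the average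
  tends to \<open>h 0\<close>.\<close>

lemma mass_ratio_continuous:
  assumes "N \<ge> 1" and h: "continuous_on {0..1} h"
  shows "continuous_on {0..1} (\<lambda>r. if r = 0 then h 0 else mass N h r / r ^ N)"
    (is "continuous_on _ ?q")
  unfolding continuous_on_eq_continuous_within
proof
  fix r :: real assume r: "r \<in> {0..1}"
  show "continuous (at r within {0..1}) ?q"
  proof (cases "r = 0")
    case True
    have "\<exists>d>0. \<forall>s\<in>{0..1}. dist s 0 < d \<longrightarrow> dist (?q s) (?q 0) < e" if "e > 0" for e
    proof -
      obtain d where d: "d > 0" "\<And>t. t \<in> {0..1} \<Longrightarrow> dist t 0 < d \<Longrightarrow> dist (h t) (h 0) < e / 2"
        using h \<open>e > 0\<close> unfolding continuous_on_iff by (metis atLeastAtMost_iff half_gt_zero order_refl zero_le_one)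
      have "dist (?q s) (?q 0) < e" if s: "s \<in> {0..1}" "dist s 0 < d" for s
      proof (cases "s = 0")
        case False
        then have s0: "0 < s" "s \<le> 1" using s by auto
        have near: "h 0 - e/2 \<le> h t \<and> h t \<le> h 0 + e/2" if "0 \<le> t" "t \<le> s" for t
          using d(2)[of t] that s by (auto simp: dist_real_def abs_if split: if_splits)
        have "mass N (\<lambda>_. h 0 - e/2) s \<le> mass N h s" "mass N h s \<le> mass N (\<lambda>_. h 0 + e/2) s"
          using near s0 h by (auto intro!: mass_mono)
        then have "(h 0 - e/2) * s ^ N \<le> mass N h s" "mass N h s \<le> (h 0 + e/2) * s ^ N"
          using mass_const[OF assms(1) s(1)] by simp_all
        then have "h 0 - e/2 \<le> mass N h s / s ^ N" "mass N h s / s ^ N \<le> h 0 + e/2"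
          using s0 by (simp_all add: pos_le_divide_eq pos_divide_le_eq)
        then show ?thesis using False \<open>e > 0\<close> by (simp add: dist_real_def abs_if)
      qed (use \<open>e > 0\<close> in simp)
      then show ?thesis using d(1) by blast
    qed
    then show ?thesis unfolding True continuous_within_eps_delta by (metis dist_commute)
  next
    case False
    have "continuous (at r within {0..1}) (mass N h)"
      using continuous_on_mass[OF h] r by (simp add: continuous_on_eq_continuous_within)
    then have "continuous (at r within {0..1}) (\<lambda>r. mass N h r / r ^ N)"
      using False by (intro continuous_intros) auto
    then show ?thesis
      by (rule continuous_transform_within[where \<delta> = "\<bar>r\<bar>"]) (use False r in \<open>auto simp: dist_real_def\<close>)
  qed
qed

lemma radial_C2:
  assumes V: "radial N h V" and N: "N \<ge> 1" and pos: "\<And>t. 0 \<le> t \<Longrightarrow> t < 1 \<Longrightarrow> 0 < h t"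
  shows "\<exists>V''. C2_01 V (\<lambda>r. - root N (mass N h r)) V''"
proof -
  have h: "continuous_on {0..1} h" using V by (simp add: radial_def)
  define q where "q = (\<lambda>r. if r = 0 then h 0 else mass N h r / r ^ N)"
  have q: "continuous_on {0..1} (\<lambda>r. root N (q r))"
    unfolding q_def by (intro continuous_on_real_root mass_ratio_continuous N h)
  \<comment> \<open>The mass is positive up to and including 1, although \<open>h\<close> may vanish
    there, as it does for an eigenfunction.\<close>
  have mpos: "0 < mass N h r" if "0 < r" "r \<le> 1" for r
    by (rule mass_pos[OF N h]) (use pos that in auto)
  have qpos: "0 < root N (q r)" if "r \<in> {0..1}" for r
    using that mpos[of r] pos[of 0] N by (auto simp: q_def)
  have rm: "root N (mass N h r) = r * root N (q r)" if "r \<in> {0..1}" for r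
    using that N by (auto simp: q_def real_root_divide real_root_power_cancel)
  \<comment> \<open>Since \<open>mass = r\<^sup>N q\<close> with \<open>q\<close> continuous and positive, the root is \<open>r\<close> times a continuous function
    and the derivative below has no singularity at 0.\<close>
  define D where "D = (\<lambda>r. h r / root N (q r) ^ (N - 1))"
  have "((\<lambda>r. root N (mass N h r)) has_real_derivative D r) (at r within {0..1})" if r: "r \<in> {0..1}" for r
  proof (cases "r = 0")
    case False
    then have r0: "0 < r" "r \<le> 1" using r by auto
    from DERIV_chain2[OF DERIV_real_root mass_has_derivative[OF h r], of N N]
    have "((\<lambda>r. root N (mass N h r)) has_real_derivative
      inverse (real N * root N (mass N h r) ^ (N - Suc 0)) * (real N * r ^ (N - 1) * h r)) (at r within {0..1})"
      using N mpos[OF r0] by simp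
    moreover have "inverse (real N * root N (mass N h r) ^ (N - Suc 0)) * (real N * r ^ (N - 1) * h r) = D r"
      unfolding rm[OF r] D_def using N r0 qpos[OF r] by (simp add: power_mult_distrib field_simps)
    ultimately show ?thesis by simp
  next
    case True
    \<comment> \<open>At the centre the difference quotient of the slope is
      \<open>root N (q r)\<close>, with limit \<open>root N (h 0)\<close>. The formula for
      \<open>D\<close> gives the same value there.\<close>
    have "root N (h 0) ^ (N - 1) * root N (h 0) = h 0"
      using N pos[of 0] power_minus_mult[of N "root N (h 0)"] by simp
    then have D0: "D 0 = root N (q 0)"
      using N pos[of 0] by (simp add: D_def q_def field_simps)
    have "((\<lambda>r. root N (q r)) \<longlongrightarrow> root N (q 0)) (at 0 within {0..1})"
      using q by (simp add: continuous_on_def)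
    then have "((\<lambda>y. (root N (mass N h y) - root N (mass N h 0)) / (y - 0)) \<longlongrightarrow> D 0) (at 0 within {0..1})"
      unfolding D0 by (rule Lim_transform_within[OF _ zero_less_one]) (use rm in auto)
    then show ?thesis unfolding True has_field_derivative_iff .
  qed
  then have "((\<lambda>r. - root N (mass N h r)) has_real_derivative - D r) (at r within {0..1})" if "r \<in> {0..1}" for r
    using that by (intro DERIV_minus) auto
  moreover have "continuous_on {0..1} (\<lambda>r. - D r)"
    unfolding D_def using qpos by (intro continuous_intros h q) fastforce
  ultimately have "C2_01 V (\<lambda>r. - root N (mass N h r)) (\<lambda>r. - D r)"
    using V unfolding C2_01_def radial_def by blast
  then show ?thesis by blast
qed

lemma radial_power_derivative:
  assumes V: "radial N h V" and N: "N \<ge> 1" and r: "0 < r" "r < 1"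
  shows "((\<lambda>t. (root N (mass N h t)) ^ N) has_real_derivative real N * r ^ (N - 1) * h r) (at r)"
proof -
  have h: "continuous_on {0..1} h" and h0: "\<forall>r\<in>{0..1}. 0 \<le> h r" using V by (auto simp: radial_def)
  have D: "(mass N h has_real_derivative real N * r ^ (N - 1) * h r) (at r)"
    using mass_has_derivative[OF h, of r N] r by (intro has_derivative_interior_unit) auto
  have eq: "root N (mass N h t) ^ N = mass N h t" if "t \<in> {0<..<1}" for t
  proof (rule real_root_pow_pos2)
    show "0 \<le> mass N h t" using h h0 that by (intro mass_nonneg) auto
  qed (use N in auto)
  show ?thesis
    by (rule has_field_derivative_transform_within_open[OF D, where S = "{0<..<1}"]) (use r eq in auto)
qed

section \<open>Translation between the eigenvalue problem and its integrated form\<close>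

lemma radial_eigen_solution:
  assumes V: "radial N (\<lambda>t. lam ^ N * V t ^ N) V" and N: "N \<ge> 1" and lam: "0 < lam"
    and pos: "\<And>t. 0 \<le> t \<Longrightarrow> t < 1 \<Longrightarrow> 0 < V t" and "V 1 = 0"
  shows "eigen_solution N lam V"
proof -
  let ?V' = "\<lambda>r. - root N (mass N (\<lambda>t. lam ^ N * V t ^ N) r)"
  obtain V'' where "C2_01 V ?V' V''"
    using radial_C2[OF V N] pos lam by force
  moreover have "((\<lambda>t. (- ?V' t) ^ N) has_real_derivative lam ^ N * real N * r ^ (N - 1) * V r ^ N) (at r)"
    if "r \<in> {0<..<1}" for r
    using radial_power_derivative[OF V N, of r] that by (simp add: mult_ac)
  ultimately show ?thesis
    unfolding eigen_solution_def using assms by (intro exI[of _ ?V'] exI[of _ V'']) auto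
qed

text \<open>The equation determines only \<open>(- w') ^ N\<close>, which for even \<open>N\<close>
  leaves the sign of \<open>w'\<close> open. Since this power is a positive mass on
  \<open>(0, 1]\<close>, \<open>w'\<close> has no zero there and keeps one sign by connectedness. A
  positive sign would let \<open>w\<close> increase to \<open>w 1 = 0\<close>, against its
  positivity.\<close>

lemma eigen_solution_radial:
  assumes w: "eigen_solution N lam w" and N: "N \<ge> 1" and lam: "0 < lam"
    and pos: "\<And>r. r \<in> {0<..<1} \<Longrightarrow> 0 < w r"
  shows "radial N (\<lambda>t. lam ^ N * w t ^ N) w" "w 1 = 0"
proof -
  obtain w' w'' where C2: "C2_01 w w' w''"
    and der: "\<And>r. r \<in> {0<..<1} \<Longrightarrow> ((\<lambda>t. (- w' t) ^ N) has_real_derivative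
              (lam ^ N * real N * r ^ (N - 1) * (w r) ^ N)) (at r)"
    and w'0: "w' 0 = 0" and w1: "w 1 = 0"
    using w unfolding eigen_solution_def by blast
  show "w 1 = 0" by fact
  let ?h = "\<lambda>t. lam ^ N * w t ^ N"
  have Dw: "(w has_real_derivative w' r) (at r within {0..1})" if "r \<in> {0..1}" for r
    using C2 that by (simp add: C2_01_def)
  have cw: "continuous_on {0..1} w" by (rule DERIV_continuous_on[OF Dw])
  have cw': "continuous_on {0..1} w'"
    using C2 by (intro DERIV_continuous_on[of _ w' w'']) (simp add: C2_01_def)
  have ch: "continuous_on {0..1} ?h" by (intro continuous_intros cw)
  have hpos: "0 < ?h t" if "0 < t" "t < 1" for t using pos[of t] lam that by simp
  have mass: "mass N ?h r = (- w' r) ^ N" if "r \<in> {0..1}" for r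
  proof (rule mass_unique[OF _ _ that])
    show "((\<lambda>r. (- w' r) ^ N) has_real_derivative real N * t ^ (N - 1) * ?h t) (at t)" if "0 < t" "t < 1" for t
      using der[of t] that by (simp add: mult_ac)
  qed (use w'0 N in \<open>auto intro!: continuous_intros cw'\<close>)
  have nz: "w' r \<noteq> 0" if "0 < r" "r \<le> 1" for r
    using mass_pos[OF N ch hpos that] mass[of r] that N by (auto simp: power_0_left)
  have neg: "w' r < 0" if r: "0 < r" "r \<le> 1" for r
  proof (rule ccontr)
    assume "\<not> w' r < 0"
    then have pr: "0 < w' r" using nz[OF r] by simp
    have "0 < w' s" if s: "0 < s" "s \<le> 1" for s
    proof (rule ccontr)
      assume ns: "\<not> 0 < w' s"
      have "connected (w' ` {0<..1})"
        by (rule connected_continuous_image[OF continuous_on_subset[OF cw']]) auto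
      from connectedD_interval[OF this, of "w' s" "w' r" 0] have "0 \<in> w' ` {0<..1}"
        using pr r s ns by simp
      then show False using nz by auto
    qed
    then have "\<exists>y. (w has_real_derivative y) (at t) \<and> 0 < y" if "1/2 < t" "t < 1" for t
      using has_derivative_interior_unit[OF Dw, of t] that by (intro exI[of _ "w' t"]) auto
    then have "w (1/2) < w 1"
      by (intro DERIV_pos_imp_increasing_open[of "1/2" 1 w] continuous_on_subset[OF cw]) auto
    then show False using pos[of "1/2"] w1 by simp
  qed
  have "root N (mass N ?h r) = - w' r" if "r \<in> {0..1}" for r
    using mass[OF that] neg[of r] w'0 that N by (cases "r = 0") (auto intro!: real_root_power_cancel)
  \<comment> \<open>Positivity of \<open>w\<close> is given only inside the interval; monotonicity
    and \<open>w 1 = 0\<close> cover the end points.\<close>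
  moreover have "0 \<le> ?h r" if r: "r \<in> {0..1}" for r
  proof -
    have "w 1 \<le> w r"
    proof (rule DERIV_nonpos_imp_decreasing_open[where f = w])
      show "continuous_on {r..1} w" using r by (intro continuous_on_subset[OF cw]) auto
      show "\<exists>y. (w has_real_derivative y) (at t) \<and> y \<le> 0" if "r < t" "t < 1" for t
        using has_derivative_interior_unit[OF Dw, of t] neg[of t] that r
        by (intro exI[of _ "w' t"]) auto
    qed (use r in auto)
    then show ?thesis using w1 lam by simp
  qed
  ultimately show "radial N ?h w"
    unfolding radial_def using ch Dw by auto
qed

section \<open>Solvability for bounded densities\<close>

text \<open>Abstracts the truncated equations: the one yielding the first eigenfunction, and the
  nonlinear one, whose barriers depend on position.\<close>

locale bounded_density =
  fixes N :: nat and H :: "real \<Rightarrow> real \<Rightarrow> real" and B :: real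
  assumes N: "N \<ge> 1"
    and H_cont: "continuous_on ({0..1} \<times> UNIV) (\<lambda>(t, s). H t s)"
    and H_nonneg: "\<And>t s. t \<in> {0..1} \<Longrightarrow> 0 \<le> H t s"
    and H_le: "\<And>t s. t \<in> {0..1} \<Longrightarrow> H t s \<le> B"
begin

text \<open>The drop of the profile between 0 and \<open>r\<close>: a solution of
  \<open>V = a - descent V\<close> solves the integrated equation with initial value
  \<open>a\<close>.\<close>

definition descent :: "(real \<Rightarrow> real) \<Rightarrow> real \<Rightarrow> real" where
  "descent h r = integral {0..r} (\<lambda>s. root N (mass N (\<lambda>t. H t (h t)) s))"

lemma density_continuous:
  assumes "continuous_on {0..1} h"
  shows "continuous_on {0..1} (\<lambda>t. H t (h t))"
proof -
  have "continuous_on {0..1} (\<lambda>t. (t, h t))" by (intro continuous_intros assms)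
  from continuous_on_compose2[OF H_cont this] show ?thesis by auto
qed

lemma slope_bounds:
  assumes "continuous_on {0..1} h" "s \<in> {0..1}"
  shows "0 \<le> root N (mass N (\<lambda>t. H t (h t)) s)" "root N (mass N (\<lambda>t. H t (h t)) s) \<le> root N B"
proof -
  have "0 \<le> mass N (\<lambda>t. H t (h t)) s"
    using assms H_nonneg by (intro mass_nonneg density_continuous) auto
  then show "0 \<le> root N (mass N (\<lambda>t. H t (h t)) s)" by (rule real_root_ge_zero)
  have "0 \<le> B" using H_nonneg[of 0 0] H_le[of 0 0] by simp
  have "mass N (\<lambda>t. H t (h t)) s \<le> mass N (\<lambda>_. B) s"
    using assms H_le by (intro mass_mono density_continuous) auto
  also have "\<dots> = B * s ^ N" using mass_const[OF N assms(2)] .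
  also have "\<dots> \<le> B * 1" using \<open>0 \<le> B\<close> assms(2) by (intro mult_left_mono power_le_one) auto
  finally show "root N (mass N (\<lambda>t. H t (h t)) s) \<le> root N B" using N by simp
qed

lemma slope_continuous:
  assumes "continuous_on {0..1} h"
  shows "continuous_on {0..1} (\<lambda>s. root N (mass N (\<lambda>t. H t (h t)) s))"
  by (intro continuous_on_real_root continuous_on_mass density_continuous assms)

lemma descent_has_derivative:
  assumes "continuous_on {0..1} h" "r \<in> {0..1}"
  shows "(descent h has_real_derivative root N (mass N (\<lambda>t. H t (h t)) r)) (at r within {0..1})"
  unfolding descent_def[abs_def]
  by (rule integral_has_real_derivative[OF slope_continuous[OF assms(1)] assms(2)])

lemma descent_continuous: "continuous_on {0..1} h \<Longrightarrow> continuous_on {0..1} (descent h)"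
  by (rule DERIV_continuous_on[OF descent_has_derivative])

lemma descent_0 [simp]: "descent h 0 = 0"
  by (simp add: descent_def)

lemma descent_lipschitz:
  assumes "continuous_on {0..1} h" "r \<in> {0..1}" "s \<in> {0..1}"
  shows "\<bar>descent h r - descent h s\<bar> \<le> root N B * \<bar>r - s\<bar>"
proof -
  have "norm (descent h r - descent h s) \<le> root N B * norm (r - s)"
  proof (rule field_differentiable_bound[OF _ descent_has_derivative[OF assms(1)]])
    show "norm (root N (mass N (\<lambda>t. H t (h t)) z)) \<le> root N B" if "z \<in> {0..1}" for z
      using slope_bounds[OF assms(1) that] by simp
  qed (use assms in auto)
  then show ?thesis by simp
qed

lemma descent_nonneg:
  assumes "continuous_on {0..1} h" "r \<in> {0..1}"
  shows "0 \<le> descent h r"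
  unfolding descent_def
proof (rule integral_nonneg)
  show "(\<lambda>s. root N (mass N (\<lambda>t. H t (h t)) s)) integrable_on {0..r}"
    using assms(2) by (intro integrable_continuous_real continuous_on_subset[OF slope_continuous[OF assms(1)]]) auto
qed (use slope_bounds(1)[OF assms(1)] assms(2) in auto)

lemma descent_le:
  assumes "continuous_on {0..1} h" "r \<in> {0..1}"
  shows "descent h r \<le> root N B"
proof -
  have "0 \<le> root N B"
    using slope_bounds[OF assms] by linarith
  then have "root N B * \<bar>r - 0\<bar> \<le> root N B" using assms(2) by (simp add: mult_left_le)
  then show ?thesis using descent_lipschitz[OF assms, of 0] by simp
qed

text \<open>Dominated convergence twice, for the mass and for the outer integral, with constant
  majorants supplied by \<open>B\<close>. It serves both continuity in the initial value and the
  removal of the delay.\<close>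

lemma descent_tendsto:
  assumes cont: "\<And>m. continuous_on {0..1} (h m)" "continuous_on {0..1} g"
    and conv: "\<And>t. t \<in> {0..1} \<Longrightarrow> (\<lambda>m. h m t) \<longlonglongrightarrow> g t"
    and r: "r \<in> {0..1}"
  shows "(\<lambda>m. descent (h m) r) \<longlonglongrightarrow> descent g r"
proof -
  have inner: "(\<lambda>m. mass N (\<lambda>t. H t (h m t)) s) \<longlonglongrightarrow> mass N (\<lambda>t. H t (g t)) s" if s: "s \<in> {0..1}" for s
    unfolding mass_def
  proof (rule dominated_convergence(2)[where h = "\<lambda>_. real N * B"])
    show "(\<lambda>t. real N * t ^ (N - 1) * H t (h m t)) integrable_on {0..s}" for m
      using s by (intro mass_integrable density_continuous cont) auto
    show "norm (real N * t ^ (N - 1) * H t (h m t)) \<le> real N * B" if "t \<in> {0..s}" for m t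
    proof -
      have t: "t \<in> {0..1}" using that s by auto
      have "t ^ (N - 1) * H t (h m t) \<le> 1 * B"
        using t H_nonneg[OF t] H_le[OF t] by (intro mult_mono power_le_one) auto
      then show ?thesis using t H_nonneg[OF t] by (simp add: mult.assoc mult_left_mono)
    qed
    show "(\<lambda>m. real N * t ^ (N - 1) * H t (h m t)) \<longlonglongrightarrow> real N * t ^ (N - 1) * H t (g t)"
      if "t \<in> {0..s}" for t
    proof (intro tendsto_intros)
      have t: "t \<in> {0..1}" using that s by auto
      have "(\<lambda>m. (t, h m t)) \<longlonglongrightarrow> (t, g t)" by (intro tendsto_intros conv[OF t])
      from continuous_on_tendsto_compose[OF H_cont this]
      show "(\<lambda>m. H t (h m t)) \<longlonglongrightarrow> H t (g t)" using t by simp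
    qed
  qed auto
  show ?thesis
    unfolding descent_def
  proof (rule dominated_convergence(2)[where h = "\<lambda>_. root N B"])
    show "(\<lambda>s. root N (mass N (\<lambda>t. H t (h m t)) s)) integrable_on {0..r}" for m
      using r by (intro integrable_continuous_real continuous_on_subset[OF slope_continuous[OF cont(1)]]) auto
    show "norm (root N (mass N (\<lambda>t. H t (h m t)) s)) \<le> root N B" if "s \<in> {0..r}" for m s
      using slope_bounds[OF cont(1), of s m] that r by simp
    show "(\<lambda>m. root N (mass N (\<lambda>t. H t (h m t)) s)) \<longlonglongrightarrow> root N (mass N (\<lambda>t. H t (g t)) s)"
      if "s \<in> {0..r}" for s
      using that r by (intro tendsto_real_root inner) auto
  qed auto
qed

text \<open>Tonelli's scheme: evaluating the density at the time \<open>t - d\<close> makes the initial value problem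
  explicit, since \<open>k\<close> iterations determine the solution on \<open>[0, k d]\<close>.\<close>

primrec delayed :: "real \<Rightarrow> nat \<Rightarrow> real \<Rightarrow> real \<Rightarrow> real" where
  "delayed d 0 a = (\<lambda>_. a)"
| "delayed d (Suc k) a = (\<lambda>r. a - descent (\<lambda>t. delayed d k a (max (t - d) 0)) r)"

lemma continuous_on_delay:
  assumes "continuous_on {0..1} h" "0 \<le> d"
  shows "continuous_on {0..1} (\<lambda>t. h (max (t - d) 0 :: real))"
proof -
  have "continuous_on {0..1} (\<lambda>t. max (t - d) 0)" by (intro continuous_intros)
  from continuous_on_compose2[OF assms(1) this] show ?thesis using assms(2) by (auto simp: image_subset_iff)
qed

lemma delayed_continuous:
  assumes "0 \<le> d"
  shows "continuous_on {0..1} (delayed d k a)"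
proof (induction k)
  case (Suc k)
  show ?case
    unfolding delayed.simps by (intro continuous_intros descent_continuous continuous_on_delay Suc assms)
qed simp

lemma delayed_tendsto:
  assumes "0 \<le> d" "A \<longlonglongrightarrow> a" "r \<in> {0..1}"
  shows "(\<lambda>m. delayed d k (A m) r) \<longlonglongrightarrow> delayed d k a r"
  using assms(3)
proof (induction k arbitrary: r)
  case (Suc k)
  show ?case
    unfolding delayed.simps
    using Suc.prems assms(1)
    by (intro tendsto_diff assms(2) descent_tendsto continuous_on_delay delayed_continuous Suc.IH) auto
qed (use assms in simp)

text \<open>Induction on \<open>k\<close>: for times up to \<open>(k + 1) d\<close> the delayed time
  is at most \<open>k d\<close>, where the two previous iterates already agree.\<close>

lemma delayed_stable:
  assumes "0 \<le> d" "0 \<le> r" "r \<le> 1" "r \<le> real k * d"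
  shows "delayed d (Suc k) a r = delayed d k a r"
  using assms(2-)
proof (induction k arbitrary: r)
  case (Suc k)
  have "delayed d (Suc k) a (max (t - d) 0) = delayed d k a (max (t - d) 0)" if "0 \<le> t" "t \<le> r" for t
  proof (rule Suc.IH)
    have "real (Suc k) * d = real k * d + d" by (simp add: algebra_simps)
    then show "max (t - d) 0 \<le> real k * d" using Suc.prems that assms(1) by auto
  qed (use Suc.prems that assms(1) in auto)
  then have "descent (\<lambda>t. delayed d (Suc k) a (max (t - d) 0)) r = descent (\<lambda>t. delayed d k a (max (t - d) 0)) r"
    unfolding descent_def by (intro integral_cong arg_cong[where f = "root N"] mass_cong) auto
  then show ?case by (subst (1 2) delayed.simps) simp
qed simp

text \<open>Shooting in the initial value \<open>a\<close>. The total descent lies between 0 and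
  \<open>root N B\<close>, so the boundary expression \<open>E\<close> is at most \<open>b\<close>
  at \<open>a = b\<close> and at least \<open>b\<close> at \<open>a = b + root N B\<close>.\<close>

lemma delayed_boundary_problem:
  assumes "0 \<le> c" "c \<le> 1"
  shows "\<exists>a V. b \<le> a \<and> a \<le> b + root N B \<and> continuous_on {0..1} V \<and>
    (\<forall>r\<in>{0..1}. V r = a - descent (\<lambda>t. V (max (t - 1 / real (Suc n)) 0)) r) \<and>
    c * V 0 + (1 - c) * V 1 = b"
proof -
  define d where "d = 1 / real (Suc n)"
  have d: "0 \<le> d" "real (Suc n) * d = 1" by (simp_all add: d_def)
  \<comment> \<open>\<open>Suc n\<close> steps of length \<open>1 / Suc n\<close> cover
    \<open>[0, 1]\<close>, so this iterate solves the delayed equation on the whole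
    interval.\<close>
  define U where "U = delayed d (Suc n)"
  have cont: "continuous_on {0..1} (U a)" for a
    unfolding U_def by (rule delayed_continuous[OF d(1)])
  have eq: "U a r = a - descent (\<lambda>t. U a (max (t - d) 0)) r" if "r \<in> {0..1}" for a r
  proof -
    have "delayed d (Suc (Suc n)) a r = U a r"
      unfolding U_def using that d(2) by (intro delayed_stable[OF d(1)]) auto
    then show ?thesis unfolding delayed.simps(2)[of d "Suc n"] U_def by simp
  qed
  define E where "E = (\<lambda>a. c * U a 0 + (1 - c) * U a 1)"
  have E: "E a = a - (1 - c) * descent (\<lambda>t. U a (max (t - d) 0)) 1" for a
  proof -
    have 0: "U a 0 = a" and 1: "U a 1 = a - descent (\<lambda>t. U a (max (t - d) 0)) 1"
      using eq[of 0 a] eq[of 1 a] by simp_all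
    show ?thesis unfolding E_def 0 1 by (simp add: algebra_simps)
  qed
  have dr: "0 \<le> (1 - c) * descent (\<lambda>t. U a (max (t - d) 0)) 1 \<and>
     (1 - c) * descent (\<lambda>t. U a (max (t - d) 0)) 1 \<le> root N B" for a
  proof -
    have "0 \<le> descent (\<lambda>t. U a (max (t - d) 0)) 1" "descent (\<lambda>t. U a (max (t - d) 0)) 1 \<le> root N B"
      by (auto intro!: descent_nonneg descent_le continuous_on_delay cont d)
    moreover from this have "(1 - c) * descent (\<lambda>t. U a (max (t - d) 0)) 1 \<le> 1 * descent (\<lambda>t. U a (max (t - d) 0)) 1"
      using assms by (intro mult_right_mono) auto
    ultimately show ?thesis using assms by auto
  qed
  \<comment> \<open>This is what the delay is for: \<open>H\<close> is merely continuous, so the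
    undelayed problem may have several solutions for one initial value, whereas \<open>U\<close> is
    an explicit continuous function of it.\<close>
  have "continuous_on UNIV E"
    unfolding continuous_on_sequentially o_def E_def U_def
    by (intro allI ballI impI tendsto_intros delayed_tendsto d) auto
  then have "continuous_on {b..b + root N B} E" by (rule continuous_on_subset) auto
  moreover have "E b \<le> b" "b \<le> E (b + root N B)" using dr[of b] dr[of "b + root N B"] E[of b] E[of "b + root N B"] by linarith+
  moreover have "b \<le> b + root N B" using dr[of 0] by simp
  ultimately obtain a where "b \<le> a" "a \<le> b + root N B" "E a = b"
    using IVT'[of E b b "b + root N B"] by auto
  then show ?thesis
    using cont eq unfolding E_def d_def by (intro exI[of _ a] exI[of _ "U a"]) auto
qed

text \<open>The initial value problem is the case \<open>c = 1\<close>, the boundary value problem the case \<open>c = 0\<close>.\<close>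

lemma exists_radial:
  assumes "0 \<le> c" "c \<le> 1"
  shows "\<exists>V. radial N (\<lambda>t. H t (V t)) V \<and> c * V 0 + (1 - c) * V 1 = b"
proof -
  define d where "d = (\<lambda>n. 1 / real (Suc n))"
  obtain A V where A: "\<And>n. b \<le> A n" "\<And>n. A n \<le> b + root N B"
    and cont: "\<And>n. continuous_on {0..1} (V n)"
    and eq: "\<And>n r. r \<in> {0..1} \<Longrightarrow> V n r = A n - descent (\<lambda>t. V n (max (t - d n) 0)) r"
    and bc: "\<And>n. c * V n 0 + (1 - c) * V n 1 = b"
    using delayed_boundary_problem[OF assms, of b] unfolding d_def by metis
  have d: "0 < d n" for n by (simp add: d_def)
  have dcont: "continuous_on {0..1} (\<lambda>t. V n (max (t - d n) 0))" for n
    using d[of n] by (intro continuous_on_delay cont) simp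
  \<comment> \<open>The Lipschitz constant does not depend on \<open>n\<close>, which gives the
    equicontinuity for Arzela-Ascoli.\<close>
  have lip: "\<bar>V n r - V n s\<bar> \<le> root N B * \<bar>r - s\<bar>" if "r \<in> {0..1}" "s \<in> {0..1}" for n r s
    using descent_lipschitz[OF dcont that] eq[OF that(1)] eq[OF that(2)] by (simp add: abs_minus_commute)
  have B0: "0 \<le> root N B" using A(1,2)[of 0] by simp
  have bound: "norm (V n r) \<le> \<bar>b\<bar> + root N B" if "r \<in> {0..1}" for n r
    using descent_nonneg[OF dcont that, of n] descent_le[OF dcont that, of n] A(1,2)[of n] eq[OF that, of n]
    by (simp add: abs_if)
  obtain g k where g: "continuous_on {0..1} g" and k: "strict_mono (k :: nat \<Rightarrow> nat)"
    and unif: "\<And>e. 0 < e \<Longrightarrow> \<exists>M. \<forall>n x. n \<ge> M \<and> x \<in> {0..1} \<longrightarrow> norm (V (k n) x - g x) < e"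
  proof (rule Arzela_Ascoli[of "{0..1::real}" V "\<bar>b\<bar> + root N B"])
    show "\<exists>\<delta>. 0 < \<delta> \<and> (\<forall>n y. y \<in> {0..1} \<and> norm (x - y) < \<delta> \<longrightarrow> norm (V n x - V n y) < e)"
      if x: "x \<in> {0..1}" and e: "0 < e" for x e
    proof (intro exI conjI allI impI)
      show "0 < e / (root N B + 1)" using e B0 by simp
      fix n y assume y: "y \<in> {0..1} \<and> norm (x - y) < e / (root N B + 1)"
      have "\<bar>V n x - V n y\<bar> \<le> root N B * \<bar>x - y\<bar>" using lip x y by simp
      also have "\<dots> \<le> (root N B + 1) * \<bar>x - y\<bar>" by (simp add: mult_right_mono)
      also have "\<dots> < e" using y B0 by (simp add: pos_less_divide_eq mult.commute)
      finally show "norm (V n x - V n y) < e" by simp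
    qed
  qed (use bound in auto)
  have lim: "(\<lambda>n. V (k n) r) \<longlonglongrightarrow> g r" if "r \<in> {0..1}" for r
    unfolding lim_sequentially dist_norm using unif that by blast
  have dlim: "(\<lambda>n. d (k n)) \<longlonglongrightarrow> 0"
    using LIMSEQ_subseq_LIMSEQ[OF LIMSEQ_inverse_real_of_nat k] by (simp add: d_def o_def inverse_eq_divide)
  \<comment> \<open>The uniform Lipschitz bound makes the error of the delayed argument at most a
    constant times the delay.\<close>
  have shift: "(\<lambda>n. V (k n) (max (t - d (k n)) 0)) \<longlonglongrightarrow> g t" if t: "t \<in> {0..1}" for t
  proof -
    have "(\<lambda>n. V (k n) (max (t - d (k n)) 0) - V (k n) t) \<longlonglongrightarrow> 0"
    proof (rule Lim_null_comparison)
      show "(\<lambda>n. root N B * d (k n)) \<longlonglongrightarrow> 0" using tendsto_mult_left[OF dlim, of "root N B"] by simp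
      have "norm (V (k n) (max (t - d (k n)) 0) - V (k n) t) \<le> root N B * d (k n)" for n
      proof -
        have "\<bar>V (k n) (max (t - d (k n)) 0) - V (k n) t\<bar> \<le> root N B * \<bar>max (t - d (k n)) 0 - t\<bar>"
          using t d[of "k n"] by (intro lip) auto
        also have "\<dots> \<le> root N B * d (k n)"
          using t d[of "k n"] B0 by (intro mult_left_mono) auto
        finally show ?thesis by simp
      qed
      then show "\<forall>\<^sub>F n in sequentially. norm (V (k n) (max (t - d (k n)) 0) - V (k n) t) \<le> root N B * d (k n)"
        by simp
    qed
    from tendsto_add[OF this lim[OF t]] show ?thesis by simp
  qed
  have V0: "V n 0 = A n" for n using eq[of 0 n] by simp
  have geq: "g r = g 0 - descent g r" if r: "r \<in> {0..1}" for r
  proof (rule LIMSEQ_unique[OF lim[OF r]])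
    have "(\<lambda>n. V (k n) 0 - descent (\<lambda>t. V (k n) (max (t - d (k n)) 0)) r) \<longlonglongrightarrow> g 0 - descent g r"
      by (intro tendsto_diff lim descent_tendsto dcont g shift r) auto
    then show "(\<lambda>n. V (k n) r) \<longlonglongrightarrow> g 0 - descent g r" using eq[OF r] V0 by simp
  qed
  have "(\<lambda>n. c * V (k n) 0 + (1 - c) * V (k n) 1) \<longlonglongrightarrow> c * g 0 + (1 - c) * g 1"
    by (intro tendsto_intros lim) auto
  then have "c * g 0 + (1 - c) * g 1 = b"
    using bc by (simp add: LIMSEQ_const_iff)
  moreover have "(g has_real_derivative - root N (mass N (\<lambda>t. H t (g t)) r)) (at r within {0..1})"
    if r: "r \<in> {0..1}" for r
  proof -
    have "((\<lambda>r. g 0 - descent g r) has_real_derivative - root N (mass N (\<lambda>t. H t (g t)) r)) (at r within {0..1})"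
      using DERIV_diff[OF DERIV_const descent_has_derivative[OF g r]] by simp
    then show ?thesis
      by (rule has_field_derivative_transform_within[OF _ zero_less_one r]) (rule geq[symmetric])
  qed
  ultimately have "radial N (\<lambda>t. H t (g t)) g \<and> c * g 0 + (1 - c) * g 1 = b"
    unfolding radial_def using density_continuous[OF g] H_nonneg by auto
  then show ?thesis by blast
qed

end

section \<open>The first eigenvalue\<close>

lemma radial_MVT:
  assumes V: "radial N h V" and "0 \<le> r" "r < s" "s \<le> 1"
  shows "\<exists>z. r < z \<and> z < s \<and> V s - V r = (s - r) * (- root N (mass N h z))"
proof -
  have "\<exists>l z. r < z \<and> z < s \<and> DERIV V z :> l \<and> V s - V r = (s - r) * l"
  proof (rule MVT)
    show "continuous_on {r..s} V"
      using assms by (intro continuous_on_subset[OF radial_continuous_on[OF V]]) auto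
    show "V differentiable (at x)" if "r < x" "x < s" for x
      using radial_has_derivative[OF V, of x] that assms(2,4) unfolding real_differentiable_def by force
  qed fact
  then obtain l z where z: "r < z" "z < s" "DERIV V z :> l" "V s - V r = (s - r) * l"
    by blast
  have "l = - root N (mass N h z)"
    using DERIV_unique[OF z(3) radial_has_derivative[OF V, of z]] z assms(2,4) by simp
  then show ?thesis using z by blast
qed

text \<open>Clipping makes the density bounded, and it is inactive up to the first zero
  \<open>p\<close>, since the profile decreases from 1. Dilating \<open>[0, p]\<close> to
  \<open>[0, 1]\<close> turns the parameter 4 into \<open>4 * p^2\<close>.\<close>

lemma eigenpair_exists:
  assumes N: "N \<ge> 1"
  shows "\<exists>lam phi. 0 < lam \<and> radial N (\<lambda>t. lam ^ N * phi t ^ N) phi \<and>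
    (\<forall>t. 0 \<le> t \<longrightarrow> t < 1 \<longrightarrow> 0 < phi t) \<and> phi 1 = 0"
proof -
  define clip where "clip = (\<lambda>s::real. max 0 (min 1 s))"
  interpret bounded_density N "\<lambda>t s. 4 ^ N * clip s ^ N" "4 ^ N"
  proof
    show "continuous_on ({0..1} \<times> UNIV) (\<lambda>(t::real, s). 4 ^ N * clip s ^ N)"
      unfolding clip_def split_beta by (intro continuous_intros)
    show "4 ^ N * clip s ^ N \<le> 4 ^ N" for s
      by (simp add: clip_def power_le_one)
  qed (use N in \<open>auto simp: clip_def\<close>)
  obtain V where V: "radial N (\<lambda>t. 4 ^ N * clip (V t) ^ N) V" and V0: "V 0 = 1"
    using exists_radial[of 1 1] by auto
  have cV: "continuous_on {0..1} V" by (rule radial_continuous_on[OF V])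
  have le1: "V t \<le> 1" if "t \<in> {0..1}" for t
    using radial_antimono[OF V, of 0 t] that V0 by simp
  let ?h = "\<lambda>t. 4 ^ N * clip (V t) ^ N"
  have ch: "continuous_on {0..1} ?h" using V by (simp add: radial_def)
  \<comment> \<open>The factor 4 is large enough for the solution started at 1 to reach 0 within \<open>[0,1]\<close>.\<close>
  have V1: "V 1 \<le> 0"
  proof (cases "V (1/2) \<le> 0")
    case True
    then show ?thesis using radial_antimono[OF V, of "1/2" 1] by simp
  next
    case False
    define v where "v = V (1/2)"
    have v: "0 < v" "v \<le> 1" using False le1[of "1/2"] by (auto simp: v_def)
    \<comment> \<open>On \<open>[0, 1/2]\<close> the density is at least \<open>(4 v) ^ N\<close>,
      so the mass at 1/2 is at least \<open>(2 v) ^ N\<close>. A slope of size \<open>2 v\<close>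
      over the remaining length 1/2 uses up the height \<open>v\<close>.\<close>
    have "2 * v \<le> root N (mass N ?h s)" if s: "1/2 \<le> s" "s \<le> 1" for s
    proof -
      have "(2 * v) ^ N = mass N (\<lambda>_. 4 ^ N * v ^ N) (1/2)"
      proof -
        have "4 ^ N * v ^ N * (1/2) ^ N = (4 * v * (1/2)) ^ N" by (simp only: power_mult_distrib)
        then show ?thesis using mass_const[OF N, of "1/2" "4 ^ N * v ^ N"] by auto
      qed
      also have "\<dots> \<le> mass N ?h (1/2)"
      proof (rule mass_mono)
        fix t :: real assume t: "0 \<le> t" "t \<le> 1/2"
        have "v \<le> V t" unfolding v_def using radial_antimono[OF V, of t "1/2"] t by simp
        then have "v \<le> clip (V t)" using v by (simp add: clip_def)
        then show "4 ^ N * v ^ N \<le> ?h t" using v by (simp add: power_mono)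
      qed (use ch in auto)
      also have "\<dots> \<le> mass N ?h s"
        using s by (intro mass_mono_radius ch) (auto simp: clip_def)
      finally have "root N ((2 * v) ^ N) \<le> root N (mass N ?h s)" using N by simp
      moreover have "root N ((2 * v) ^ N) = 2 * v" using N v by (intro real_root_power_cancel) auto
      ultimately show ?thesis by simp
    qed
    moreover obtain z where z: "1/2 < z" "z < 1" "V 1 - V (1/2) = (1 - 1/2) * (- root N (mass N ?h z))"
      using radial_MVT[OF V, of "1/2" 1] by auto
    ultimately have "2 * v \<le> root N (mass N ?h z)" by simp
    with z(3) show ?thesis unfolding v_def[symmetric] by (simp add: field_simps)
  qed
  have "compact ({0..1} \<inter> V -` {..0})"
    using continuous_closed_preimage[OF cV closed_atLeastAtMost closed_atMost]
    by (auto simp: compact_eq_bounded_closed intro: bounded_subset[OF bounded_closed_interval])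
  moreover have "1 \<in> {0..1} \<inter> V -` {..0}" using V1 by simp
  ultimately obtain p where p: "p \<in> {0..1} \<inter> V -` {..0}" "\<And>y. y \<in> {0..1} \<inter> V -` {..0} \<Longrightarrow> p \<le> y"
    using compact_attains_inf[of "{0..1} \<inter> V -` {..0}"] by blast
  have p0: "0 < p" using p(1) V0 by (cases "p = 0") auto
  have p1: "p \<le> 1" using p(1) by simp
  have "\<exists>x\<ge>0. x \<le> p \<and> V x = 0"
    using p p0 p1 V0 by (intro IVT2' continuous_on_subset[OF cV]) auto
  \<comment> \<open>A zero exists in \<open>[0, p]\<close> by the intermediate value theorem, and
    minimality of \<open>p\<close> forces it to be \<open>p\<close>.\<close>
  then have Vp: "V p = 0" using p(2) p1 by force
  have pt: "p * t \<in> {0..1}" if "t \<in> {0..1}" for t using that p0 p1 by (auto intro: mult_le_one)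
  have pos: "0 < V (p * t)" if t: "0 \<le> t" "t < 1" for t
  proof -
    have "p * t < p" using t p0 by simp
    then show ?thesis using p(2)[of "p * t"] pt[of t] t by force
  qed
  have "radial N (\<lambda>t. (4 * p\<^sup>2) ^ N * V (p * t) ^ N) (\<lambda>t. V (p * t))"
  proof (rule radial_cong[OF radial_dilate[OF V N]])
    fix t :: real assume t: "t \<in> {0..1}"
    have "0 \<le> V (p * t)" using pos[of t] Vp t by (cases "t = 1") auto
    then have "clip (V (p * t)) = V (p * t)" using le1[OF pt[OF t]] by (simp add: clip_def)
    then show "(p\<^sup>2) ^ N * (4 ^ N * clip (V (p * t)) ^ N) = (4 * p\<^sup>2) ^ N * V (p * t) ^ N"
      by (simp add: power_mult_distrib)
  qed (use p0 p1 in auto)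
  then show ?thesis
    using p0 pos Vp by (intro exI[of _ "4 * p\<^sup>2"] exI[of _ "\<lambda>t. V (p * t)"]) auto
qed

text \<open>The slope is largest in size at 1. Together with \<open>radial_ge_linear\<close> this is
  a Hopf-type estimate that makes positive eigenfunctions comparable up to a constant.\<close>

lemma radial_le_linear:
  assumes V: "radial N h V" and N: "N \<ge> 1" and r: "0 \<le> r" "r \<le> 1"
  shows "V r - V 1 \<le> root N (mass N h 1) * (1 - r)"
proof (cases "r = 1")
  case False
  have h: "continuous_on {0..1} h" "\<forall>t\<in>{0..1}. 0 \<le> h t" using V by (auto simp: radial_def)
  obtain z where z: "r < z" "z < 1" "V 1 - V r = (1 - r) * (- root N (mass N h z))"
    using radial_MVT[OF V, of r 1] False r by auto
  have "mass N h z \<le> mass N h 1" using h z r by (intro mass_mono_radius) auto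
  then have "root N (mass N h z) \<le> root N (mass N h 1)" using N by simp
  then have "(1 - r) * root N (mass N h z) \<le> (1 - r) * root N (mass N h 1)"
    using r by (intro mult_left_mono) auto
  then show ?thesis using z(3) by (simp add: mult.commute)
qed simp

text \<open>By concavity the profile lies above its chord from 0 to 1.\<close>

lemma radial_ge_linear:
  assumes V: "radial N h V" and N: "N \<ge> 1" and pos: "\<And>t. 0 < t \<Longrightarrow> t < 1 \<Longrightarrow> 0 < h t"
    and "V 1 = 0" and r: "0 \<le> r" "r \<le> 1"
  shows "V 0 * (1 - r) \<le> V r"
proof (cases "r = 0 \<or> r = 1")
  case True then show ?thesis using assms by auto
next
  case False
  have "- V ((1 - r) * 0 + r * 1) < (1 - r) * - V 0 + r * - V 1"
    using radial_strictly_convex[OF V N pos] False r unfolding strictly_convex_on_def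
    by (metis atLeastAtMost_iff less_eq_real_def zero_less_one zero_neq_one)
  then show ?thesis using assms by (simp add: algebra_simps)
qed

text \<open>Each comparison improves the constant in \<open>k * v \<le> w\<close> by the factor
  \<open>mu / lam > 1\<close>. Iteration makes it unbounded, which is impossible at 1/2.\<close>

lemma eigenvalue_not_less:
  assumes N: "N \<ge> 1" and lam: "0 < lam" "lam < mu"
    and v: "radial N (\<lambda>t. lam ^ N * v t ^ N) v" "v 1 = 0" "\<And>t. t \<in> {0<..<1} \<Longrightarrow> 0 < v t"
    and w: "radial N (\<lambda>t. mu ^ N * w t ^ N) w" "w 1 = 0" "\<And>t. t \<in> {0<..<1} \<Longrightarrow> 0 < w t"
  shows False
proof -
  have v0: "0 \<le> v t" if "t \<in> {0..1}" for t using radial_antimono[OF v(1), of t 1] that v(2) by simp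
  have w0: "0 < w 0" using radial_antimono[OF w(1), of 0 "1/2"] w(3)[of "1/2"] by simp
  define C where "C = root N (mass N (\<lambda>t. lam ^ N * v t ^ N) 1)"
  have "0 < mass N (\<lambda>t. lam ^ N * v t ^ N) 1"
    by (rule mass_pos[OF N]) (use v lam in \<open>auto simp: radial_def\<close>)
  then have C: "0 < C" using N by (simp add: C_def)
  \<comment> \<open>The linear bounds \<open>v r \<le> C * (1 - r)\<close> and
    \<open>w 0 * (1 - r) \<le> w r\<close> dictate this quotient.\<close>
  define k where "k = w 0 / C"
  have k: "0 < k" using w0 C by (simp add: k_def)
  have start: "k * v r \<le> w r" if r: "r \<in> {0..1}" for r
  proof -
    have "k * v r \<le> k * (C * (1 - r))"
      using radial_le_linear[OF v(1) N, of r] r v(2) k by (intro mult_left_mono) (auto simp: C_def)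
    also have "\<dots> = w 0 * (1 - r)" using C by (simp add: k_def)
    also have "\<dots> \<le> w r"
      by (rule radial_ge_linear[OF w(1) N _ w(2)]) (use w(3) lam r in auto)
    finally show ?thesis .
  qed
  have iter: "\<forall>r\<in>{0..1}. (mu / lam) ^ n * k * v r \<le> w r" for n
  proof (induction n)
    case 0 then show ?case using start by simp
  next
    case (Suc n)
    define j where "j = (mu / lam) ^ n * k"
    have j: "0 \<le> j" using lam k by (simp add: j_def)
    \<comment> \<open>The improved multiple of \<open>v\<close> has density
      \<open>mu ^ N * (j * v t) ^ N\<close>, which the induction hypothesis bounds by the density of
      \<open>w\<close>.\<close>
    have R: "radial N (\<lambda>t. (mu / lam * j) ^ N * (lam ^ N * v t ^ N)) (\<lambda>t. mu / lam * j * v t)"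
      by (rule radial_scale[OF v(1) N]) (use lam j in auto)
    have "mu / lam * j * v r \<le> w r" if r: "r \<in> {0..1}" for r
    proof (rule radial_compare[OF w(1) R N _ _ r])
      fix t :: real assume t: "t \<in> {0..1}"
      have "(mu / lam * j) ^ N * (lam ^ N * v t ^ N) = mu ^ N * (j * v t) ^ N"
        unfolding power_mult_distrib[symmetric] using lam by simp
      also have "\<dots> \<le> mu ^ N * w t ^ N"
        using Suc t lam j v0[OF t] by (intro mult_left_mono power_mono) (auto simp: j_def)
      finally show "(mu / lam * j) ^ N * (lam ^ N * v t ^ N) \<le> mu ^ N * w t ^ N" .
    qed (use v w in auto)
    then show ?case by (simp add: j_def mult_ac)
  qed
  have kv: "0 < k * v (1/2)" using k v(3)[of "1/2"] by simp
  have "1 < mu / lam" using lam by simp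
  from real_arch_pow[OF this] obtain n where "w (1/2) / (k * v (1/2)) < (mu / lam) ^ n" by blast
  then have "w (1/2) < (mu / lam) ^ n * (k * v (1/2))" using kv by (simp add: pos_divide_less_eq)
  then show False using iter[of n] by (auto simp: mult.assoc dest!: bspec[of _ _ "1/2"])
qed

text \<open>Justifies the definite description: \<open>eigenvalue_not_less\<close>, applied in both
  orders, excludes every other eigenvalue with a positive eigenfunction.\<close>

lemma lambda1_eigenfunction:
  assumes N: "N \<ge> 1"
  shows "\<exists>phi. 0 < lambda1 N \<and> radial N (\<lambda>t. lambda1 N ^ N * phi t ^ N) phi \<and>
    (\<forall>t. 0 \<le> t \<longrightarrow> t < 1 \<longrightarrow> 0 < phi t) \<and> phi 1 = 0"
proof -
  obtain lam phi where phi: "0 < lam" "radial N (\<lambda>t. lam ^ N * phi t ^ N) phi"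
    "\<And>t. 0 \<le> t \<Longrightarrow> t < 1 \<Longrightarrow> 0 < phi t" "phi 1 = 0"
    using eigenpair_exists[OF N] by blast
  have "lambda1 N = lam"
    unfolding lambda1_def
  proof (rule the_equality)
    show "lam > 0 \<and> (\<exists>v. eigen_solution N lam v \<and> (\<forall>r\<in>{0<..<1}. v r > 0))"
      using radial_eigen_solution[OF phi(2) N phi(1,3,4)] phi by auto
    fix mu assume "mu > 0 \<and> (\<exists>v. eigen_solution N mu v \<and> (\<forall>r\<in>{0<..<1}. v r > 0))"
    then obtain v where mu: "0 < mu" and v: "eigen_solution N mu v" "\<And>r. r \<in> {0<..<1} \<Longrightarrow> 0 < v r"
      by blast
    note rv = eigen_solution_radial[OF v(1) N mu v(2)]
    have pos: "\<And>r. r \<in> {0<..<1} \<Longrightarrow> 0 < phi r" using phi(3) by simp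
    show "mu = lam"
      using eigenvalue_not_less[OF N mu _ rv v(2) phi(2,4) pos]
        eigenvalue_not_less[OF N phi(1) _ phi(2,4) pos rv v(2)] by (cases mu lam rule: linorder_cases) auto
  qed
  then show ?thesis using phi by blast
qed

section \<open>Sub- and supersolutions\<close>

text \<open>The limit controls large arguments; on the remaining compact interval the excess is
  bounded and is absorbed in \<open>D\<close>.\<close>

lemma growth_bound:
  fixes g :: "real \<Rightarrow> real"
  assumes "continuous_on UNIV g" "((\<lambda>s. g s / s ^ N) \<longlongrightarrow> l) at_top" "l < L"
  shows "\<exists>D\<ge>0. \<forall>s\<ge>0. g s \<le> L * s ^ N + D"
proof -
  have "\<forall>\<^sub>F s in at_top. g s / s ^ N < L"
    using assms(2,3) by (rule order_tendstoD)
  then obtain S0 where S0: "\<And>s. s \<ge> S0 \<Longrightarrow> g s / s ^ N < L"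
    unfolding eventually_at_top_linorder by blast
  define S where "S = max S0 1"
  have tail: "g s \<le> L * s ^ N" if "s \<ge> S" for s
    using S0[of s] that by (simp add: S_def pos_divide_less_eq)
  have "continuous_on {0..S} (\<lambda>s. g s - L * s ^ N)"
    by (intro continuous_intros continuous_on_subset[OF assms(1)]) auto
  moreover have "{0..S} \<noteq> {}" by (simp add: S_def)
  ultimately obtain m where m: "\<And>s. s \<in> {0..S} \<Longrightarrow> g s - L * s ^ N \<le> m"
    using continuous_attains_sup[OF compact_Icc] by meson
  have "g s \<le> L * s ^ N + max m 0" if "s \<ge> 0" for s
    using tail[of s] m[of s] that by (cases "s \<ge> S") auto
  then show ?thesis by (intro exI[of _ "max m 0"]) auto
qed

text \<open>For small \<open>s\<close> the singular quotient dominates \<open>K\<close>; for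
  \<open>s\<close> up to \<open>T\<close> the minimum of \<open>g\<close> is positive and beats
  small \<open>x\<close>. Here \<open>x\<close> stands for the subsolution and \<open>s\<close> for
  any value above it.\<close>

lemma small_argument_bound:
  fixes g :: "real \<Rightarrow> real"
  assumes N: "N \<ge> 1" and g: "continuous_on UNIV g" and gpos: "\<And>s. 0 < s \<Longrightarrow> 0 < g s"
    and g0: "filterlim (\<lambda>s. g s / s ^ N) at_top (at_right 0)" and "0 \<le> K"
  shows "\<exists>e>0. \<forall>x s. 0 \<le> x \<longrightarrow> x \<le> e \<longrightarrow> x \<le> s \<longrightarrow> s \<le> T \<longrightarrow> 0 < s \<longrightarrow> K * x ^ N \<le> g s"
proof -
  have "\<forall>\<^sub>F s in at_right 0. K \<le> g s / s ^ N"
    using g0 by (simp add: filterlim_at_top)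
  then obtain d where d: "d > 0" "\<And>s. 0 < s \<Longrightarrow> s < d \<Longrightarrow> K \<le> g s / s ^ N"
    unfolding eventually_at_right_field by auto
  have "continuous_on {d..max d T} g" by (rule continuous_on_subset[OF g]) auto
  from continuous_attains_inf[OF compact_Icc _ this] obtain z where
    z: "z \<in> {d..max d T}" "\<And>s. s \<in> {d..max d T} \<Longrightarrow> g z \<le> g s" by auto
  have gz: "0 < g z" using gpos z(1) d(1) by auto
  \<comment> \<open>Chosen so that \<open>(K + 1) * e ^ N\<close> is the minimum of
    \<open>g\<close>; \<open>K + 1\<close> keeps the denominator positive when
    \<open>K = 0\<close>.\<close>
  define e where "e = root N (g z / (K + 1))"
  have e: "0 < e" "e ^ N = g z / (K + 1)"
    using gz N assms(5) by (simp_all add: e_def real_root_pow_pos2)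
  have "K * x ^ N \<le> g s" if x: "0 \<le> x" "x \<le> e" "x \<le> s" "s \<le> T" "0 < s" for x s
  proof (cases "s < d")
    case True
    have "K * x ^ N \<le> K * s ^ N" using x assms(5) by (intro mult_left_mono power_mono) auto
    also have "\<dots> \<le> g s" using d(2)[OF x(5) True] x(5) by (simp add: pos_le_divide_eq)
    finally show ?thesis .
  next
    case False
    have "K * x ^ N \<le> (K + 1) * e ^ N" using x assms(5) by (intro mult_mono power_mono) auto
    also have "\<dots> = g z" using e assms(5) by simp
    also have "\<dots> \<le> g s" using False x by (intro z(2)) auto
    finally show ?thesis .
  qed
  then show ?thesis using e(1) by blast
qed

lemma positive_solution_exists:
  fixes g :: "real \<Rightarrow> real"
  assumes N: "N \<ge> 1" and g: "continuous_on UNIV g" and gpos: "\<And>s. 0 < s \<Longrightarrow> 0 < g s"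
    and g0: "filterlim (\<lambda>s. g s / s ^ N) at_top (at_right 0)"
    and ginf: "((\<lambda>s. g s / s ^ N) \<longlongrightarrow> finf ^ N) at_top" and finf: "0 < finf"
    and lam: "0 < lam" "lam < lambda1 N / finf"
  shows "\<exists>V. radial N (\<lambda>t. lam ^ N * g (V t)) V \<and> (\<forall>t. 0 \<le> t \<longrightarrow> t < 1 \<longrightarrow> 0 < V t) \<and> V 1 = 0"
proof -
  define L where "L = lambda1 N"
  obtain phi where L: "0 < L" and phi: "radial N (\<lambda>t. L ^ N * phi t ^ N) phi"
    and phi_pos: "\<And>t. 0 \<le> t \<Longrightarrow> t < 1 \<Longrightarrow> 0 < phi t" and phi1: "phi 1 = 0"
    using lambda1_eigenfunction[OF N] unfolding L_def by blast
  have g_nonneg: "0 \<le> g s" if "0 \<le> s" for s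
    using continuous_ge_on_closure[of "{0<..}" g s 0] continuous_on_subset[OF g] that gpos
    by (auto simp: less_imp_le)
  \<comment> \<open>The midpoint of \<open>finf\<close> and \<open>L / lam\<close>: growth at rate
    \<open>q ^ N\<close> is allowed by the limit and still gives \<open>lam * q < L\<close>.\<close>
  define q where "q = (finf + L / lam) / 2"
  have "finf < L / lam" using lam finf by (simp add: L_def field_simps)
  then have q: "finf < q" "lam * q < L"
    using lam by (auto simp: q_def field_simps)
  have "finf ^ N < q ^ N" using q finf N by (intro power_strict_mono) auto
  then obtain D where D: "0 \<le> D" "\<And>s. 0 \<le> s \<Longrightarrow> g s \<le> q ^ N * s ^ N + D"
    using growth_bound[OF g ginf] by blast
  \<comment> \<open>\<open>c\<^sup>2\<close> is the midpoint of \<open>lam * q / L\<close> and 1, so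
    the dilated eigenfunction keeps a parameter \<open>L * c\<^sup>2\<close> above
    \<open>lam * q\<close>.\<close>
  define c where "c = sqrt ((1 + lam * q / L) / 2)"
  have x: "0 < lam * q / L" "lam * q / L < 1" using lam q finf L by simp_all
  then have c2: "c\<^sup>2 = (1 + lam * q / L) / 2" by (simp add: c_def)
  have c: "0 < c" "c < 1" using x by (auto simp: c_def)
  have "y < (1 + y) / 2" if "y < 1" for y :: real using that by simp
  from this[OF x(2)] have "lam * q / L < c\<^sup>2" unfolding c2 .
  then have "lam * q < L * c\<^sup>2" using L by (simp add: pos_divide_less_eq mult.commute)
  then have ab: "(lam * q) ^ N < (L * c\<^sup>2) ^ N" using lam q finf N by (intro power_strict_mono) auto
  have ct: "c * t \<in> {0..1}" "c * t \<le> t" "c * t \<le> c" if "t \<in> {0..1}" for t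
    using that c by (auto intro: mult_le_one mult_left_le_one_le mult_left_le)
  have phi_anti: "phi s \<le> phi r" if "0 \<le> r" "r \<le> s" "s \<le> 1" for r s
    using radial_antimono[OF phi that] .
  have phi0: "0 \<le> phi t" if "t \<in> {0..1}" for t using phi_anti[of t 1] phi1 that by simp
  define m where "m = phi c"
  have m: "0 < m" using phi_pos c by (simp add: m_def)
  \<comment> \<open>Height at which the gap between the two rates absorbs the constant
    \<open>lam ^ N * D\<close>; \<open>Y \<ge> 1\<close> allows passing from \<open>Y\<close> to
    \<open>Y ^ N\<close>.\<close>
  define Y where "Y = max 1 (lam ^ N * D / ((L * c\<^sup>2) ^ N - (lam * q) ^ N))"
  have "lam ^ N * D / ((L * c\<^sup>2) ^ N - (lam * q) ^ N) \<le> Y" by (simp add: Y_def)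
  also have "Y \<le> Y ^ N" using N by (intro self_le_power) (auto simp: Y_def)
  finally have Y: "lam ^ N * D \<le> ((L * c\<^sup>2) ^ N - (lam * q) ^ N) * Y ^ N"
    using ab by (simp add: pos_divide_le_eq mult.commute)
  \<comment> \<open>\<open>m\<close> is the least value of \<open>phi (c * t)\<close> on
    \<open>[0, 1]\<close>, so this factor lifts the barrier to height at least
    \<open>Y\<close>.\<close>
  define M where "M = Y / m"
  have M: "0 < M" using m by (simp add: M_def Y_def)
  \<comment> \<open>A dilated eigenfunction is a supersolution that stays bounded away from 0 on \<open>[0,1]\<close>.\<close>
  define psi where "psi = (\<lambda>t. M * phi (c * t))"
  have psi: "radial N (\<lambda>t. M ^ N * ((c\<^sup>2) ^ N * (L ^ N * phi (c * t) ^ N))) psi"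
    unfolding psi_def by (rule radial_scale[OF radial_dilate[OF phi N] N]) (use c M in auto)
  have psi_ge: "Y \<le> psi t" if "t \<in> {0..1}" for t
  proof -
    have "m \<le> phi (c * t)" unfolding m_def using ct[OF that] c by (intro phi_anti) auto
    then have "M * m \<le> psi t" unfolding psi_def using M by simp
    then show ?thesis using m by (simp add: M_def)
  qed
  \<comment> \<open>Stated for every value below the barrier, so that it applies to the truncated
    argument before the solution itself is located.\<close>
  have upper: "lam ^ N * g s \<le> M ^ N * ((c\<^sup>2) ^ N * (L ^ N * phi (c * t) ^ N))"
    if t: "t \<in> {0..1}" and s: "0 \<le> s" "s \<le> psi t" for t s
  proof -
    have Y0: "0 \<le> Y" by (simp add: Y_def)
    have "lam ^ N * g s \<le> lam ^ N * (q ^ N * s ^ N + D)"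
      using D(2)[OF s(1)] lam by simp
    also have "\<dots> = (lam * q) ^ N * s ^ N + lam ^ N * D"
      by (simp add: power_mult_distrib algebra_simps)
    also have "\<dots> \<le> (lam * q) ^ N * psi t ^ N + ((L * c\<^sup>2) ^ N - (lam * q) ^ N) * psi t ^ N"
    proof (rule add_mono)
      show "(lam * q) ^ N * s ^ N \<le> (lam * q) ^ N * psi t ^ N"
        using s lam q finf by (intro mult_left_mono power_mono) auto
      have "((L * c\<^sup>2) ^ N - (lam * q) ^ N) * Y ^ N \<le> ((L * c\<^sup>2) ^ N - (lam * q) ^ N) * psi t ^ N"
        using psi_ge[OF t] Y0 ab by (intro mult_left_mono power_mono) auto
      then show "lam ^ N * D \<le> ((L * c\<^sup>2) ^ N - (lam * q) ^ N) * psi t ^ N" using Y by linarith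
    qed
    also have "\<dots> = M ^ N * ((c\<^sup>2) ^ N * (L ^ N * phi (c * t) ^ N))"
      by (simp add: psi_def power_mult_distrib algebra_simps)
    finally show ?thesis .
  qed
  obtain e where e: "0 < e" "\<And>x s. \<lbrakk>0 \<le> x; x \<le> e; x \<le> s; s \<le> M * phi 0; 0 < s\<rbrakk> \<Longrightarrow> (L / lam) ^ N * x ^ N \<le> g s"
    using small_argument_bound[OF N g gpos g0, of "(L / lam) ^ N" "M * phi 0"] L lam by auto
  \<comment> \<open>The bound by \<open>M\<close> orders the barriers; the bound by
    \<open>e / phi 0\<close> makes the subsolution small enough for the estimate near 0.\<close>
  define k where "k = min M (e / phi 0)"
  have A: "0 < phi 0" using phi_pos by simp
  have k: "0 < k" "k \<le> M" "k * phi 0 \<le> e"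
    using M e(1) A by (auto simp: k_def min_def field_simps)
  have psi_le: "psi t \<le> M * phi 0" if "t \<in> {0..1}" for t
    unfolding psi_def using ct[OF that] M by (intro mult_left_mono phi_anti) auto
  have order: "k * phi t \<le> psi t" if t: "t \<in> {0..1}" for t
    unfolding psi_def using ct[OF t] t k M phi0[OF t] by (intro mult_mono phi_anti) auto
  have lower: "k ^ N * (L ^ N * phi t ^ N) \<le> lam ^ N * g s"
    if t: "t \<in> {0..1}" and s: "k * phi t \<le> s" "s \<le> psi t" for t s
  proof -
    have 0: "0 \<le> k * phi t" using k phi0[OF t] by simp
    have "k * phi t \<le> k * phi 0" using t k by (intro mult_left_mono phi_anti) auto
    then have ke: "k * phi t \<le> e" using k(3) by linarith
    have "(L / lam) ^ N * (k * phi t) ^ N \<le> g s"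
    proof (cases "s = 0")
      \<comment> \<open>Here the subsolution vanishes as well, and the claim reduces to
        \<open>g 0 \<ge> 0\<close>.\<close>
      case True
      then have "k * phi t = 0" using 0 s by simp
      then show ?thesis unfolding \<open>k * phi t = 0\<close> using True g_nonneg[of 0] N by (simp add: power_0_left)
    next
      case False
      then show ?thesis using 0 ke s psi_le[OF t] by (intro e(2)) auto
    qed
    then have "lam ^ N * ((L / lam) ^ N * (k * phi t) ^ N) \<le> lam ^ N * g s"
      using lam by simp
    moreover have "lam ^ N * ((L / lam) ^ N * (k * phi t) ^ N) = k ^ N * (L ^ N * phi t ^ N)"
      using lam by (simp add: power_mult_distrib power_divide)
    ultimately show ?thesis by simp
  qed
  define clip where "clip = (\<lambda>t s. max (k * phi t) (min (psi t) s))"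
  have clip: "k * phi t \<le> clip t s" "clip t s \<le> psi t" "0 \<le> clip t s" if "t \<in> {0..1}" for t s
    using order[OF that] phi0[OF that] k by (auto simp: clip_def le_max_iff_disj)
  have "continuous_on {0..M * phi 0} g" by (rule continuous_on_subset[OF g]) auto
  moreover have "{0..M * phi 0} \<noteq> {}" using M A by simp
  ultimately obtain G where G: "\<And>s. s \<in> {0..M * phi 0} \<Longrightarrow> g s \<le> G"
    using continuous_attains_sup[OF compact_Icc] by meson
  interpret bounded_density N "\<lambda>t s. lam ^ N * g (clip t s)" "lam ^ N * G"
  proof
    have 1: "continuous_on ({0..1} \<times> UNIV) (\<lambda>p. phi (fst p))"
      by (rule continuous_on_compose2[OF radial_continuous_on[OF phi]]) (auto intro!: continuous_intros)
    have 2: "continuous_on ({0..1} \<times> UNIV) (\<lambda>p. psi (fst p))"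
      by (rule continuous_on_compose2[OF radial_continuous_on[OF psi]]) (auto intro!: continuous_intros)
    have "continuous_on ({0..1} \<times> UNIV) (\<lambda>p. clip (fst p) (snd p))"
      unfolding clip_def by (intro continuous_intros 1 2)
    then have "continuous_on ({0..1} \<times> UNIV) (\<lambda>p. g (clip (fst p) (snd p)))"
      by (rule continuous_on_compose2[OF g]) auto
    then show "continuous_on ({0..1} \<times> UNIV) (\<lambda>(t, s). lam ^ N * g (clip t s))"
      unfolding split_beta by (intro continuous_intros)
    show "0 \<le> lam ^ N * g (clip t s)" if "t \<in> {0..1}" for t s
      using clip(3)[OF that] lam g_nonneg by simp
    show "lam ^ N * g (clip t s) \<le> lam ^ N * G" if "t \<in> {0..1}" for t s
      using clip(2,3)[OF that, of s] psi_le[OF that] lam by (intro mult_left_mono G) auto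
  qed (rule N)
  obtain V where V: "radial N (\<lambda>t. lam ^ N * g (clip t (V t))) V" and V1: "V 1 = 0"
    using exists_radial[of 0 0] by auto
  \<comment> \<open>The truncated argument always lies between the barriers, so their densities
    compare with that of \<open>V\<close> wherever \<open>V\<close> is; hence so do the
    profiles.\<close>
  have below: "V t \<le> psi t" if t: "t \<in> {0..1}" for t
  proof (rule radial_compare[OF psi V N _ _ t])
    show "V 1 \<le> psi 1" using V1 psi_ge[of 1] by (simp add: Y_def)
  qed (use upper clip in auto)
  have above: "k * phi t \<le> V t" if t: "t \<in> {0..1}" for t
  proof (rule radial_compare[OF V radial_scale[OF phi N] N _ _ t])
    show "k * phi 1 \<le> V 1" using V1 phi1 by simp
  qed (use lower clip k in auto)
  have "radial N (\<lambda>t. lam ^ N * g (V t)) V"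
    by (rule radial_cong[OF V]) (use below above in \<open>simp add: clip_def\<close>)
  moreover have "0 < V t" if "0 \<le> t" "t < 1" for t
    using above[of t] mult_pos_pos[OF k(1) phi_pos[OF that]] that by simp
  ultimately show ?thesis using V1 by blast
qed

section \<open>The two solutions of opposite sign\<close>

lemma C2_01_minus:
  assumes "C2_01 u u' u''"
  shows "C2_01 (\<lambda>r. - u r) (\<lambda>r. - u' r) (\<lambda>r. - u'' r)"
  using assms unfolding C2_01_def by (intro conjI ballI continuous_on_minus DERIV_minus) auto

theorem theorem4p8:
  fixes N :: nat and f :: "real \<Rightarrow> real" and finf lam :: real
  assumes N: "N \<ge> 1"
    and f_cont: "continuous_on UNIV f"
    and f1: "\<And>s. s \<noteq> 0 \<Longrightarrow> f s * s ^ N > 0"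
    and f0: "filterlim (\<lambda>s. f s / s ^ N) at_top (at 0)"
    and finf_pos: "finf > 0"
    and finf: "((\<lambda>s. f s / s ^ N) \<longlongrightarrow> finf ^ N) at_infinity"
    and lam: "0 < lam" "lam < lambda1 N / finf"
  shows "\<exists>up um. MO_solution N f lam up \<and> MO_solution N f lam um \<and>
           (\<forall>r\<in>{0<..<1}. up r > 0) \<and> strictly_concave_on {0<..<1} up \<and>
           (\<forall>r\<in>{0<..<1}. um r < 0) \<and> strictly_convex_on {0<..<1} um"
proof -
  \<comment> \<open>For a positive decreasing solution \<open>V\<close>, \<open>(V') ^ N\<close>
    equals \<open>(- 1) ^ N * (- V') ^ N\<close> and \<open>f\<close> is evaluated at
    \<open>- V\<close>, which gives this \<open>g\<close>. For the negative solution
    \<open>- W\<close> both signs disappear and \<open>f\<close> itself is used.\<close>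
  define g where "g = (\<lambda>s. (- 1) ^ N * f (- s))"
  have gf: "g s / s ^ N = f (- s) / (- s) ^ N" for s
    unfolding g_def power_minus[of s N] by (cases "even N") auto
  have neg0: "filterlim uminus (at 0) (at_right (0::real))"
    by (rule filterlim_atI) (auto simp: eventually_at_filter intro!: tendsto_eq_intros)
  have neginf: "filterlim uminus at_infinity (at_top :: real filter)"
    by (rule filterlim_mono[OF filterlim_uminus_at_bot_at_top at_bot_le_at_infinity order_refl])
  obtain V where V: "radial N (\<lambda>t. lam ^ N * g (V t)) V"
    and Vpos: "\<And>t. 0 \<le> t \<Longrightarrow> t < 1 \<Longrightarrow> 0 < V t" and V1: "V 1 = 0"
  proof -
    have "\<exists>V. radial N (\<lambda>t. lam ^ N * g (V t)) V \<and> (\<forall>t. 0 \<le> t \<longrightarrow> t < 1 \<longrightarrow> 0 < V t) \<and> V 1 = 0"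
    proof (rule positive_solution_exists[OF N _ _ _ _ finf_pos lam])
      have "continuous_on UNIV (\<lambda>s. f (- s))"
        by (rule continuous_on_compose2[OF f_cont]) (auto intro!: continuous_intros)
      then show "continuous_on UNIV g" unfolding g_def by (intro continuous_intros)
      show "0 < g s" if "0 < s" for s
        using f1[of "- s"] that unfolding g_def power_minus[of s N]
        by (cases "even N") (auto simp: zero_less_mult_iff mult_less_0_iff)
      show "filterlim (\<lambda>s. g s / s ^ N) at_top (at_right 0)"
        unfolding gf by (rule filterlim_compose[OF f0 neg0])
      show "((\<lambda>s. g s / s ^ N) \<longlongrightarrow> finf ^ N) at_top"
        unfolding gf by (rule filterlim_compose[OF finf neginf])
    qed
    then show ?thesis using that by blast
  qed
  obtain W where W: "radial N (\<lambda>t. lam ^ N * f (W t)) W"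
    and Wpos: "\<And>t. 0 \<le> t \<Longrightarrow> t < 1 \<Longrightarrow> 0 < W t" and W1: "W 1 = 0"
  proof -
    have "\<exists>W. radial N (\<lambda>t. lam ^ N * f (W t)) W \<and> (\<forall>t. 0 \<le> t \<longrightarrow> t < 1 \<longrightarrow> 0 < W t) \<and> W 1 = 0"
    proof (rule positive_solution_exists[OF N f_cont _ _ _ finf_pos lam])
      show "0 < f s" if "0 < s" for s
        using f1[of s] that by (simp add: zero_less_mult_iff)
      show "filterlim (\<lambda>s. f s / s ^ N) at_top (at_right 0)"
        using f0 by (rule filterlim_mono) (auto intro: at_le)
      show "((\<lambda>s. f s / s ^ N) \<longlongrightarrow> finf ^ N) at_top"
        using finf by (rule tendsto_mono[OF at_top_le_at_infinity])
    qed
    then show ?thesis using that by blast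
  qed
  have gV: "0 < lam ^ N * g (V t)" if "0 \<le> t" "t < 1" for t
    using Vpos[OF that] f1[of "- V t"] lam unfolding g_def power_minus[of "V t" N]
    by (cases "even N") (auto simp: zero_less_mult_iff mult_less_0_iff)
  have fW: "0 < lam ^ N * f (W t)" if "0 \<le> t" "t < 1" for t
    using Wpos[OF that] f1[of "W t"] lam by (auto simp: zero_less_mult_iff)
  have "MO_solution N f lam V"
  proof -
    let ?m = "mass N (\<lambda>t. lam ^ N * g (V t))"
    obtain V'' where "C2_01 V (\<lambda>r. - root N (?m r)) V''"
      using radial_C2[OF V N gV] by blast
    moreover have "((\<lambda>t. (- root N (?m t)) ^ N) has_real_derivative
        lam ^ N * real N * r ^ (N - 1) * f (- V r)) (at r)" if "r \<in> {0<..<1}" for r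
    proof -
      have "((\<lambda>t. (- 1) ^ N * root N (?m t) ^ N) has_real_derivative
          (- 1) ^ N * (real N * r ^ (N - 1) * (lam ^ N * g (V r)))) (at r)"
        using radial_power_derivative[OF V N] that by (intro DERIV_cmult) auto
      moreover have "(- 1) ^ N * (real N * r ^ (N - 1) * (lam ^ N * g (V r))) =
          lam ^ N * real N * r ^ (N - 1) * f (- V r)"
        by (cases "even N") (simp_all add: g_def)
      ultimately show ?thesis unfolding power_minus[of "root N _" N] by (simp only:)
    qed
    ultimately show ?thesis
      unfolding MO_solution_def using V1
      by (intro exI[of _ "\<lambda>r. - root N (?m r)"] exI[of _ V'']) auto
  qed
  moreover have "MO_solution N f lam (\<lambda>r. - W r)"
  proof -
    let ?m = "mass N (\<lambda>t. lam ^ N * f (W t))"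
    obtain W'' where "C2_01 W (\<lambda>r. - root N (?m r)) W''"
      using radial_C2[OF W N fW] by blast
    from C2_01_minus[OF this] have "C2_01 (\<lambda>r. - W r) (\<lambda>r. root N (?m r)) (\<lambda>r. - W'' r)"
      by simp
    moreover have "((\<lambda>t. root N (?m t) ^ N) has_real_derivative
        lam ^ N * real N * r ^ (N - 1) * f (- (- W r))) (at r)" if "r \<in> {0<..<1}" for r
      using radial_power_derivative[OF W N, of r] that by (simp add: mult_ac)
    ultimately show ?thesis
      unfolding MO_solution_def using W1
      by (intro exI[of _ "\<lambda>r. root N (?m r)"] exI[of _ "\<lambda>r. - W'' r"]) auto
  qed
  moreover have "strictly_concave_on {0<..<1} V"
    unfolding strictly_concave_on_def
    by (rule strictly_convex_on_subset[OF radial_strictly_convex[OF V N]]) (use gV in auto)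
  moreover have "strictly_convex_on {0<..<1} (\<lambda>r. - W r)"
    by (rule strictly_convex_on_subset[OF radial_strictly_convex[OF W N]]) (use fW in auto)
  ultimately show ?thesis
    using Vpos Wpos by (intro exI[of _ V] exI[of _ "\<lambda>r. - W r"]) auto
qed

end
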